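(* For any given $k\ge1$ the Hamiltonian vector field of $I_k$, $X_{I_k}=(\nabla_pI_k,-\nabla_wI_k)$, defines a map $X_{I_k}:\mathcal{H}^{1,+}_0\times\mathcal{H}^{1,+}_0\to\mathcal{H}^{1,+}_0\times\mathcal{H}^{1,+}_0$ that is well defined and analytic.
   Context: All spaces are complex, and "analytic" means complex-analytic between complex Banach spaces. $\mathbb{T}=\mathbb{R}/\mathbb{Z}$, $f_k=\int_0^1 f(y)e^{-2\pi i k y}\,dy$, $\langle k\rangle:=|k|$ for $k\neq0$, $\langle0\rangle:=1$. $\mathcal{H}^1$ is the Hilbert space of functions $f:\mathbb{T}\to\mathbb{C}$ with $\|f\|_{\mathcal{H}^1}=(\sum_{k}|f_k|^2\langle k\rangle^2)^{1/2}<\infty$ (a Banach algebra under pointwise multiplication). $\mathcal{H}^{1,+}=\{f\in\mathcal{H}^1:f_k=0\text{ for }k<0\}$, $\mathcal{H}^{1,+}_0=\{f\in\mathcal{H}^1:f_k=0\text{ for }k\le0\}$, with Fourier-truncation projections $\Pi^+,\Pi^+_0$; bilinear pairing $\langle f,g\rangle=\sum_kf_kg_k$; $\check f(y)=f(-y)$; $(Lf)(y)=f(y)e^{-2\pi iy}$. For $w,p\in\mathcal{H}^{1,+}_0$, $k\ge1$: $I_k(w,p)=\langle A_k(w)\Gamma(w)p,p\rangle$ with $A_k(w)g=g\,\Pi^+(L^{k+1}w)-w\,\Pi^+(L^{k+1}g)$ and $\Gamma(w)p=\Pi^+_0(w\check p)$. For a $C^1$ function $F$ on $\mathcal{H}^{1,+}_0\times\mathcal{H}^{1,+}_0$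 the gradients $\nabla_wF,\nabla_pF$ are a priori distributions on $\mathbb{T}$ with Fourier coefficients vanishing for $k\le0$, determined by $\langle\nabla_wF,\delta w\rangle=(D_1F)(\delta w)$, $\langle\nabla_pF,\delta p\rangle=(D_2F)(\delta p)$ for all $\delta w,\delta p\in\mathcal{H}^{1,+}_0$ ($D_1,D_2$ partial differentials in $w$, $p$). "Well defined" means that the gradients lie in $\mathcal{H}^{1,+}_0$. *)

theory Defs
  imports "HOL-Analysis.Analysis"
begin

section \<open>Complex normed spaces and analytic maps\<close>

class complex_normed_vector = real_normed_vector +
  fixes scaleC :: "complex \<Rightarrow> 'a \<Rightarrow> 'a"  (infixr \<open>*\<^sub>C\<close> 75)
  assumes scaleC_add_right: "c *\<^sub>C (x + y) = c *\<^sub>C x + c *\<^sub>C y"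
    and scaleC_add_left: "(c + d) *\<^sub>C x = c *\<^sub>C x + d *\<^sub>C x"
    and scaleC_scaleC: "c *\<^sub>C d *\<^sub>C x = (c * d) *\<^sub>C x"
    and scaleC_of_real: "of_real r *\<^sub>C x = r *\<^sub>R x"
    and norm_scaleC: "norm (c *\<^sub>C x) = cmod c * norm x"

class complex_banach = complex_normed_vector + complete_space
begin
subclass banach ..
end

instantiation complex :: complex_banach
begin
definition scaleC_complex :: "complex \<Rightarrow> complex \<Rightarrow> complex"
  where "scaleC_complex c x = c * x"
instance
  by standard (auto simp: scaleC_complex_def algebra_simps norm_mult scaleR_conv_of_real)
end

instantiation prod :: (complex_normed_vector, complex_normed_vector) complex_normed_vector
begin
definition scaleC_prod :: "complex \<Rightarrow> 'a \<times> 'b \<Rightarrow> 'a \<times> 'b"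
  where "scaleC_prod c x = (c *\<^sub>C fst x, c *\<^sub>C snd x)"
instance
proof
  fix c :: complex and x :: "'a \<times> 'b"
  have "(cmod c * norm (fst x))\<^sup>2 + (cmod c * norm (snd x))\<^sup>2 = (cmod c)\<^sup>2 * ((norm (fst x))\<^sup>2 + (norm (snd x))\<^sup>2)"
    by (simp add: power_mult_distrib distrib_left)
  then show "norm (c *\<^sub>C x) = cmod c * norm x"
    by (simp add: scaleC_prod_def norm_prod_def norm_scaleC real_sqrt_mult)
qed (auto simp: scaleC_prod_def scaleC_add_right scaleC_add_left scaleC_scaleC scaleC_of_real prod_eq_iff)
end

instance prod :: (complex_banach, complex_banach) complex_banach ..

text \<open>A bounded complex \<open>n\<close>-linear map; its arguments are the values \<open>v 0, \<dots>, v (n - 1)\<close> of a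
  sequence \<open>v\<close>, on the rest of which it does not depend.\<close>

definition bounded_multilinearC :: "nat \<Rightarrow> ((nat \<Rightarrow> 'a::complex_normed_vector) \<Rightarrow> 'b::complex_normed_vector) \<Rightarrow> bool"
  where "bounded_multilinearC n M \<longleftrightarrow>
    (\<forall>v v'. (\<forall>i<n. v i = v' i) \<longrightarrow> M v = M v') \<and>
    (\<forall>v i x y. i < n \<longrightarrow> M (v(i := x + y)) = M (v(i := x)) + M (v(i := y))) \<and>
    (\<forall>v i c x. i < n \<longrightarrow> M (v(i := c *\<^sub>C x)) = c *\<^sub>C M (v(i := x))) \<and>
    (\<exists>C. \<forall>v. norm (M v) \<le> C * (\<Prod>i<n. norm (v i)))"

text \<open>Analyticity on the whole space: around each point the map is the uniform sum, on some ball,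
  of a series of bounded homogeneous polynomials \<open>h \<mapsto> M n (h, \<dots>, h)\<close> of degree \<open>n\<close>.\<close>

definition analytic_map :: "('a::complex_banach \<Rightarrow> 'b::complex_banach) \<Rightarrow> bool"
  where "analytic_map f \<longleftrightarrow> (\<forall>a. \<exists>r>0. \<exists>M. (\<forall>n. bounded_multilinearC n (M n)) \<and>
    uniform_limit (ball 0 r) (\<lambda>N h. \<Sum>n<N. M n (\<lambda>_. h)) (\<lambda>h. f (a + h)) sequentially)"

definition C1_map :: "('a::complex_banach \<Rightarrow> 'b::complex_banach) \<Rightarrow> bool"
  where "C1_map F \<longleftrightarrow> (\<exists>F'. (\<forall>x. (F has_derivative blinfun_apply (F' x)) (at x)) \<and>
    (\<forall>x c h. blinfun_apply (F' x) (c *\<^sub>C h) = c *\<^sub>C blinfun_apply (F' x) h) \<and>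
    continuous_on UNIV F')"


section \<open>Fourier coefficients and the space \<open>H\<^sup>1\<close>\<close>

text \<open>Functions on the torus are 1-periodic functions on the real line.\<close>

definition fexp :: "int \<Rightarrow> real \<Rightarrow> complex"
  where "fexp k y = exp (2 * of_real pi * \<i> * of_int k * of_real y)"

definition fourier :: "(real \<Rightarrow> complex) \<Rightarrow> int \<Rightarrow> complex"
  where "fourier f k = integral {0..1} (\<lambda>y. f y * fexp (- k) y)"

definition jap :: "int \<Rightarrow> real"
  where "jap k = (if k = 0 then 1 else \<bar>of_int k\<bar>)"

text \<open>An element of \<open>H\<^sup>1\<close>, a priori a class of functions modulo null sets, is identified with its
  unique continuous representative.\<close>

definition H1 :: "(real \<Rightarrow> complex) set"
  where "H1 = {f. continuous_on UNIV f \<and> (\<forall>y. f (y + 1) = f y) \<and>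
    (\<lambda>k. (cmod (fourier f k))\<^sup>2 * (jap k)\<^sup>2) summable_on UNIV}"

definition H1_norm :: "(real \<Rightarrow> complex) \<Rightarrow> real"
  where "H1_norm f = sqrt (\<Sum>\<^sub>\<infinity>k. (cmod (fourier f k))\<^sup>2 * (jap k)\<^sup>2)"

definition H1_plus0 :: "(real \<Rightarrow> complex) set"
  where "H1_plus0 = {f \<in> H1. \<forall>k\<le>0. fourier f k = 0}"


subsection \<open>Weighted square-summable sequences\<close>

definition wsq :: "(int \<Rightarrow> complex) \<Rightarrow> int \<Rightarrow> real"
  where "wsq a k = (cmod (a k))\<^sup>2 * (jap k)\<^sup>2"

lemma jap_ge_1: "1 \<le> jap k"
  by (auto simp: jap_def)

lemma wsq_nonneg [simp]: "0 \<le> wsq a k"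
  by (simp add: wsq_def)

lemma norm_sq_le_wsq: "(cmod (a k))\<^sup>2 \<le> wsq a k"
  using mult_left_mono[of 1 "(jap k)\<^sup>2" "(cmod (a k))\<^sup>2"] jap_ge_1[of k]
  by (simp add: wsq_def)

lemma wsq_scale: "wsq (\<lambda>k. c * a k) k = (cmod c)\<^sup>2 * wsq a k"
  by (simp add: wsq_def norm_mult power_mult_distrib)

lemma wsq_sum_triangle:
  assumes "wsq a summable_on UNIV" "wsq b summable_on UNIV" "finite F"
  shows "(\<Sum>k\<in>F. wsq (\<lambda>k. a k + b k) k) \<le> (sqrt (infsum (wsq a) UNIV) + sqrt (infsum (wsq b) UNIV))\<^sup>2"
proof -
  have L: "L2_set (\<lambda>k. cmod (c k) * jap k) F \<le> sqrt (infsum (wsq c) UNIV)"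
    if "wsq c summable_on UNIV" for c
  proof -
    have "(\<Sum>k\<in>F. wsq c k) \<le> infsum (wsq c) UNIV"
      by (rule finite_sum_le_infsum[OF that \<open>finite F\<close>]) auto
    then show ?thesis
      by (simp add: L2_set_def wsq_def power_mult_distrib)
  qed
  have "sqrt (\<Sum>k\<in>F. wsq (\<lambda>k. a k + b k) k) = L2_set (\<lambda>k. cmod (a k + b k) * jap k) F"
    by (simp add: L2_set_def wsq_def power_mult_distrib)
  also have "\<dots> \<le> L2_set (\<lambda>k. cmod (a k) * jap k + cmod (b k) * jap k) F"
  proof (rule L2_set_mono)
    show "cmod (a k + b k) * jap k \<le> cmod (a k) * jap k + cmod (b k) * jap k" for k
      using mult_right_mono[OF norm_triangle_ineq[of "a k" "b k"], of "jap k"] jap_ge_1[of k]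
      by (simp add: distrib_right)
    show "0 \<le> cmod (a k + b k) * jap k" for k
      using jap_ge_1[of k] by simp
  qed
  also have "\<dots> \<le> L2_set (\<lambda>k. cmod (a k) * jap k) F + L2_set (\<lambda>k. cmod (b k) * jap k) F"
    by (rule L2_set_triangle_ineq)
  also have "\<dots> \<le> sqrt (infsum (wsq a) UNIV) + sqrt (infsum (wsq b) UNIV)"
    by (intro add_mono L assms)
  finally have "sqrt (\<Sum>k\<in>F. wsq (\<lambda>k. a k + b k) k) \<le> sqrt (infsum (wsq a) UNIV) + sqrt (infsum (wsq b) UNIV)" .
  from sqrt_le_D[OF this] show ?thesis .
qed

lemma wsq_summable_add:
  assumes "wsq a summable_on UNIV" "wsq b summable_on UNIV"
  shows "wsq (\<lambda>k. a k + b k) summable_on UNIV"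
  by (rule nonneg_bdd_above_summable_on) (use wsq_sum_triangle[OF assms] in \<open>auto intro!: bdd_aboveI2\<close>)

lemma wsq_triangle:
  assumes "wsq a summable_on UNIV" "wsq b summable_on UNIV"
  shows "sqrt (infsum (wsq (\<lambda>k. a k + b k)) UNIV) \<le> sqrt (infsum (wsq a) UNIV) + sqrt (infsum (wsq b) UNIV)"
proof (rule real_le_lsqrt)
  show "infsum (wsq (\<lambda>k. a k + b k)) UNIV \<le> (sqrt (infsum (wsq a) UNIV) + sqrt (infsum (wsq b) UNIV))\<^sup>2"
    by (rule infsum_le_finite_sums[OF wsq_summable_add[OF assms]]) (use wsq_sum_triangle[OF assms] in auto)
qed (auto intro!: add_nonneg_nonneg infsum_nonneg)

lemma wsq_summable_scale:
  assumes "wsq a summable_on UNIV"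
  shows "wsq (\<lambda>k. c * a k) summable_on UNIV"
  unfolding wsq_scale by (rule summable_on_cmult_right[OF assms])

lemma summable_inverse_jap_sq: "(\<lambda>k. inverse ((jap k)\<^sup>2)) summable_on UNIV"
proof -
  have "(\<lambda>n. inverse (real n ^ 2)) summable_on UNIV"
    by (rule norm_summable_imp_summable_on) (use inverse_power_summable[of 2, where 'a = real] in simp)
  then have *: "(\<lambda>n. inverse (real n ^ 2)) summable_on {1..}"
    by (rule summable_on_subset_banach) auto
  have "bij_betw nat {1..} {1..}"
    by (rule bij_betwI[where g = int]) auto
  from summable_on_reindex_bij_betw[OF this, of "\<lambda>n. inverse (real n ^ 2)"] *
  have "(\<lambda>k. inverse (real (nat k) ^ 2)) summable_on {1..}"
    by simp
  then have "(\<lambda>k. inverse ((jap k)\<^sup>2)) summable_on {1..}"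
    by (rule summable_on_cong[THEN iffD1, rotated]) (auto simp: jap_def)
  moreover have "bij_betw (\<lambda>k. nat (- k)) {..-1} {1..}"
    by (rule bij_betwI[where g = "\<lambda>n. - int n"]) auto
  from summable_on_reindex_bij_betw[OF this, of "\<lambda>n. inverse (real n ^ 2)"] *
  have "(\<lambda>k. inverse (real (nat (- k)) ^ 2)) summable_on {..-1}"
    by simp
  then have "(\<lambda>k. inverse ((jap k)\<^sup>2)) summable_on {..-1}"
    by (rule summable_on_cong[THEN iffD1, rotated]) (auto simp: jap_def)
  moreover have "(\<lambda>k. inverse ((jap k)\<^sup>2)) summable_on {0}"
    by simp
  ultimately have "(\<lambda>k. inverse ((jap k)\<^sup>2)) summable_on (({1..} \<union> {..-1}) \<union> {0})"
    by (intro summable_on_Un_disjoint) auto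
  also have "({1..} \<union> {..-1}) \<union> {0} = (UNIV :: int set)"
    by auto
  finally show ?thesis .
qed

lemma wsq_summable_imp_abs_summable:
  assumes "wsq a summable_on UNIV"
  shows "(\<lambda>k. cmod (a k)) summable_on UNIV"
proof (rule summable_on_comparison_test[OF summable_on_add[OF assms summable_inverse_jap_sq]])
  fix k
  have "0 \<le> (cmod (a k) * jap k - inverse (jap k))\<^sup>2"
    by simp
  also have "\<dots> = wsq a k + inverse ((jap k)\<^sup>2) - 2 * cmod (a k)"
    using jap_ge_1[of k] by (simp add: power2_diff wsq_def power_mult_distrib power_inverse)
  finally have "2 * cmod (a k) \<le> wsq a k + inverse ((jap k)\<^sup>2)"
    by simp
  then show "cmod (a k) \<le> wsq a k + inverse ((jap k)\<^sup>2)"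
    using norm_ge_zero[of "a k"] by linarith
qed simp


subsection \<open>Fourier series\<close>

lemma continuous_on_fexp [continuous_intros]: "continuous_on S (fexp k)"
  unfolding fexp_def by (intro continuous_intros)

lemma norm_fexp [simp]: "cmod (fexp k y) = 1"
  by (simp add: fexp_def norm_exp_eq_Re)

lemma fexp_0 [simp]: "fexp 0 y = 1"
  by (simp add: fexp_def)

lemma fexp_mult: "fexp j y * fexp k y = fexp (j + k) y"
  by (simp add: fexp_def algebra_simps flip: exp_add)

lemma fexp_periodic: "fexp k (y + 1) = fexp k y"
proof -
  have "fexp k (y + 1) = fexp k y * exp (2 * of_int k * of_real pi * \<i>)"
    by (simp add: fexp_def distrib_left exp_add mult_ac)
  also have "exp (2 * of_int k * of_real pi * \<i>) = 1"
    using exp_integer_2pi[of "of_int k"] by (simp add: algebra_simps)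
  finally show ?thesis by simp
qed

lemma has_integral_fexp: "(fexp k has_integral (if k = 0 then 1 else 0)) {0..1}"
proof (cases "k = 0")
  case True
  then show ?thesis
    using has_integral_const_real[of "1::complex" 0 1] by (simp add: fexp_def[abs_def])
next
  case False
  define c where "c = 2 * of_real pi * \<i> * of_int k"
  have c: "c \<noteq> 0" using False by (simp add: c_def)
  have "((\<lambda>y. exp (c * of_real y) / c) has_vector_derivative fexp k y) (at y within {0..1})" for y
  proof -
    have "((\<lambda>z. exp (c * z) / c) has_field_derivative exp (c * of_real y)) (at (of_real y))"
      using c by (auto intro!: derivative_eq_intros)
    from has_vector_derivative_real_field[OF this] show ?thesis
      by (simp add: fexp_def c_def)
  qed
  from fundamental_theorem_of_calculus[of 0 1, OF _ this]
  have "(fexp k has_integral (exp (c * of_real 1) / c - exp (c * of_real 0) / c)) {0..1}"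
    by simp
  moreover have "exp (c * of_real 1) = 1"
    using fexp_periodic[of k 0] by (simp add: fexp_def c_def)
  ultimately show ?thesis using False by simp
qed

lemma fourier_integrable:
  assumes "continuous_on UNIV f"
  shows "(\<lambda>y. f y * fexp k y) integrable_on {0..1}"
  by (rule integrable_continuous_interval)
    (intro continuous_intros continuous_on_subset[OF assms] subset_UNIV)

lemma fourier_add:
  assumes "continuous_on UNIV f" "continuous_on UNIV g"
  shows "fourier (\<lambda>y. f y + g y) k = fourier f k + fourier g k"
  using assms by (simp add: fourier_def distrib_right Henstock_Kurzweil_Integration.integral_add fourier_integrable)

lemma fourier_scale: "fourier (\<lambda>y. c * f y) k = c * fourier f k"
  by (simp add: fourier_def mult.assoc)

lemma fourier_series:
  assumes "(\<lambda>k. cmod (a k)) summable_on UNIV"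
  defines "f \<equiv> \<lambda>y. \<Sum>\<^sub>\<infinity>k. a k * fexp k y"
  shows "continuous_on UNIV f" "f (y + 1) = f y" "fourier f k = a k"
proof -
  have u: "uniform_limit UNIV (\<lambda>F y. \<Sum>k\<in>F. a k * fexp k y) f (finite_subsets_at_top UNIV)"
    unfolding f_def by (rule Weierstrass_m_test_general[OF _ assms(1)]) (simp add: norm_mult)
  show cont: "continuous_on UNIV f"
    by (rule uniform_limit_theorem[OF _ u]) (auto intro!: always_eventually continuous_intros)
  show "f (y + 1) = f y"
    by (simp add: f_def fexp_periodic)
  have "uniform_limit {0..1} (\<lambda>F y. fexp (- k) y * (\<Sum>j\<in>F. a j * fexp j y)) (\<lambda>y. fexp (- k) y * f y) (finite_subsets_at_top UNIV)"
  proof (rule uniform_lim_mult)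
    show "bounded (f ` {0..1})"
      by (intro compact_imp_bounded compact_continuous_image continuous_on_subset[OF cont]) auto
    show "bounded (fexp (- k) ` {0..1})"
      by (auto intro!: boundedI[where B = 1])
    show "uniform_limit {0..1} (\<lambda>F y. \<Sum>j\<in>F. a j * fexp j y) f (finite_subsets_at_top UNIV)"
      by (rule uniform_limit_on_subset[OF u]) simp
  qed (rule uniform_limit_const)
  then obtain I J where I: "\<And>F. ((\<lambda>y. fexp (- k) y * (\<Sum>j\<in>F. a j * fexp j y)) has_integral I F) {0..1}"
    and J: "((\<lambda>y. fexp (- k) y * f y) has_integral J) {0..1}"
    and lim: "(I \<longlongrightarrow> J) (finite_subsets_at_top UNIV)"
    by (rule uniform_limit_integral) (auto intro!: continuous_intros)
  have "I F = (\<Sum>j\<in>F. a j * (if j - k = 0 then 1 else 0))" if "finite F" for F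
  proof (rule has_integral_unique[OF I])
    have "((\<lambda>y. \<Sum>j\<in>F. a j * fexp (j - k) y) has_integral (\<Sum>j\<in>F. a j * (if j - k = 0 then 1 else 0))) {0..1}"
      by (intro has_integral_sum that has_integral_mult_right has_integral_fexp)
    moreover have "(\<lambda>y. \<Sum>j\<in>F. a j * fexp (j - k) y) = (\<lambda>y. fexp (- k) y * (\<Sum>j\<in>F. a j * fexp j y))"
      by (simp add: sum_distrib_left mult.left_commute[of "fexp (- k) _"] fexp_mult)
    ultimately show "((\<lambda>y. fexp (- k) y * (\<Sum>j\<in>F. a j * fexp j y)) has_integral (\<Sum>j\<in>F. a j * (if j - k = 0 then 1 else 0))) {0..1}"
      by simp
  qed
  then have "I F = a k" if "finite F" "{k} \<subseteq> F" for F
    using that by (simp add: if_distrib[of "\<lambda>x. _ * x"] sum.delta cong: if_cong)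
  then have "\<forall>\<^sub>F F in finite_subsets_at_top UNIV. I F = a k"
    unfolding eventually_finite_subsets_at_top by (intro exI[of _ "{k}"]) auto
  then have "(I \<longlongrightarrow> a k) (finite_subsets_at_top UNIV)"
    by (rule tendsto_eventually)
  with lim have "J = a k"
    by (intro tendsto_unique[OF _ lim]) auto
  with J show "fourier f k = a k"
    by (simp add: fourier_def mult.commute integral_unique)
qed

lemma polynomial_annihilation:
  assumes "real_polynomial_function p"
    and "continuous_on UNIV f" "\<And>k. integral {0..1} (\<lambda>y. f y * fexp k y) = 0"
  shows "continuous_on UNIV (\<lambda>y. f y * of_real (p (fexp 1 y))) \<and>
    (\<forall>k. integral {0..1} (\<lambda>y. (f y * of_real (p (fexp 1 y))) * fexp k y) = 0)"
  using assms
proof (induction p arbitrary: f rule: real_polynomial_function.induct)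
  case (linear p)
  interpret p: bounded_linear p by (rule linear)
  define c where "c = Complex (p 1 / 2) (- p \<i> / 2)"
  have pe: "of_real (p (fexp 1 y)) = c * fexp 1 y + cnj c * fexp (- 1) y" for y
  proof -
    have e: "fexp (- 1) y = cnj (fexp 1 y)"
      by (simp add: fexp_def exp_cnj)
    have "p z = Re z * p 1 + Im z * p \<i>" for z
    proof -
      have "z = Re z *\<^sub>R 1 + Im z *\<^sub>R \<i>" by (simp add: complex_eq_iff)
      then have "p z = p (Re z *\<^sub>R 1 + Im z *\<^sub>R \<i>)" by simp
      then show ?thesis by (simp only: p.add p.scaleR real_scaleR_def)
    qed
    from this[of "fexp 1 y"] show ?thesis unfolding e
      by (simp add: complex_eq_iff c_def algebra_simps)
  qed
  have eq: "(f y * of_real (p (fexp 1 y))) * fexp k y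
      = c * (f y * fexp (1 + k) y) + cnj c * (f y * fexp (- 1 + k) y)" for k y
    unfolding pe fexp_mult[symmetric] by (simp add: algebra_simps)
  have "integral {0..1} (\<lambda>y. (f y * of_real (p (fexp 1 y))) * fexp k y) = 0" for k
    unfolding eq
    by (subst Henstock_Kurzweil_Integration.integral_add)
      (use linear fourier_integrable[of f] in \<open>auto intro!: integrable_on_mult_right\<close>)
  moreover have "continuous_on UNIV (\<lambda>y. f y * of_real (p (fexp 1 y)))"
    by (intro continuous_intros linear p.continuous_on)
  ultimately show ?case by simp
next
  case (const c)
  have "(\<lambda>y. f y * of_real c * fexp k y) = (\<lambda>y. of_real c * (f y * fexp k y))" for k
    by (simp add: fun_eq_iff)
  moreover have "continuous_on UNIV (\<lambda>y. f y * of_real c)"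
    by (intro continuous_intros const)
  ultimately show ?case using const by simp
next
  case (add p q)
  note p = add.IH(1)[OF add.prems] and q = add.IH(2)[OF add.prems]
  then show ?case
    by (auto intro!: continuous_intros simp: distrib_left distrib_right
      Henstock_Kurzweil_Integration.integral_add fourier_integrable)
next
  case (mult p q)
  note q = mult.IH(2)[OF mult.prems]
  from mult.IH(1)[OF conjunct1[OF q] conjunct2[OF q, rule_format]] show ?case
    by (simp add: mult.assoc mult.commute[of "of_real (p _)" "of_real (q _)"])
qed

lemma fourier_eq_0_imp_eq_0:
  assumes cont: "continuous_on UNIV f" and per: "\<And>y. f (y + 1) = f y"
    and zero: "\<And>k. fourier f k = 0"
  shows "f y = 0"
proof -
  let ?I = "{0..1::real}" and ?S = "sphere (0::complex) 1"
  have ann: "integral ?I (\<lambda>y. f y * fexp k y) = 0" for k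
    using zero[of "- k"] by (simp add: fourier_def)
  have per_int: "f (y + of_int n) = f y" for y n
  proof (induction n rule: int_induct[where k = 0])
    case (step1 i) then show ?case using per[of "y + of_int i"] by (simp add: algebra_simps)
  next
    case (step2 i) then show ?case using per[of "y + of_int i - 1"] by (simp add: algebra_simps)
  qed simp
  have surj: "\<exists>y\<in>?I. fexp 1 y = z" if "z \<in> ?S" for z
  proof
    have "Arg2pi z / (2 * pi) \<in> ?I"
      using Arg2pi_ge_0[of z] less_imp_le[OF Arg2pi_lt_2pi[of z]] by (simp add: divide_simps)
    then show "Arg2pi z / (2 * pi) \<in> ?I" .
    show "fexp 1 (Arg2pi z / (2 * pi)) = z"
      using that Arg2pi_eq[of z] by (simp add: fexp_def mult.commute)
  qed
  have wd: "f x = f y" if "fexp 1 x = fexp 1 y" for x y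
  proof -
    from that obtain n where "2 * of_real pi * \<i> * of_real x = 2 * of_real pi * \<i> * of_real y + (2 * of_int n * of_real pi) * \<i>"
      by (auto simp: fexp_def exp_eq)
    then have "2 * of_real pi * \<i> * of_real x = 2 * of_real pi * \<i> * of_real (y + of_int n)"
      by (simp add: algebra_simps)
    then have "x = y + of_int n"
      by (subst (asm) mult_cancel_left) (simp add: of_real_eq_iff del: of_real_add)
    then show ?thesis using per_int by simp
  qed
  define g where "g z = f (SOME y. y \<in> ?I \<and> fexp 1 y = z)" for z
  have g: "g (fexp 1 y) = f y" for y
  proof -
    obtain x where "x \<in> ?I" "fexp 1 x = fexp 1 y" using surj[of "fexp 1 y"] by auto
    then have "\<exists>x. x \<in> ?I \<and> fexp 1 x = fexp 1 y" by blast
    from someI_ex[OF this] show ?thesis unfolding g_def by (intro wd) blast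
  qed
  have "continuous_on ?S g"
    unfolding continuous_on_closed_vimage[OF closed_sphere]
  proof (intro allI impI)
    fix B :: "complex set" assume "closed B"
    then have "closed (f -` B)" using cont by (simp add: continuous_on_closed_vimage)
    then have "compact (fexp 1 ` (?I \<inter> f -` B))"
      by (intro compact_continuous_image continuous_on_fexp compact_Int_closed) auto
    moreover have "fexp 1 ` (?I \<inter> f -` B) = g -` B \<inter> ?S"
      using surj g by fastforce
    ultimately show "closed (g -` B \<inter> ?S)" by (metis compact_imp_closed)
  qed
  have intf: "(\<lambda>y. (cmod (f y))\<^sup>2) integrable_on ?I"
    by (rule integrable_continuous_interval)
      (intro continuous_intros continuous_on_subset[OF cont] subset_UNIV)
  have "compact (f ` ?I)"
    by (intro compact_continuous_image continuous_on_subset[OF cont]) auto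
  then obtain B where B: "B > 0" "\<And>y. y \<in> ?I \<Longrightarrow> cmod (f y) \<le> B"
    using bounded_pos compact_imp_bounded by (metis image_eqI)
  have "integral ?I (\<lambda>y. (cmod (f y))\<^sup>2) \<le> 0"
  proof (rule field_le_epsilon)
    fix e :: real assume "0 < e"
    with B have "0 < e / B" by simp
    from Stone_Weierstrass_polynomial_function[OF compact_sphere \<open>continuous_on ?S g\<close> this]
    obtain p where p: "polynomial_function p" "\<And>z. z \<in> ?S \<Longrightarrow> cmod (g z - p z) < e / B"
      by blast
    define q where "q y = p (fexp 1 y)" for y
    have re: "real_polynomial_function (\<lambda>z. Re (p z))" "real_polynomial_function (\<lambda>z. Im (p z))"
      using p(1) bounded_linear_Re bounded_linear_Im unfolding polynomial_function_def o_def by auto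
    note a1 = polynomial_annihilation[OF re(1) cont ann] and a2 = polynomial_annihilation[OF re(2) cont ann]
    have i1: "((\<lambda>y. f y * of_real (Re (q y))) has_integral 0) ?I"
      using a1 fourier_integrable[of "\<lambda>y. f y * of_real (Re (q y))" 0]
      by (auto simp: q_def has_integral_iff dest: spec[of _ 0])
    have i2: "((\<lambda>y. f y * of_real (Im (q y))) has_integral 0) ?I"
      using a2 fourier_integrable[of "\<lambda>y. f y * of_real (Im (q y))" 0]
      by (auto simp: q_def has_integral_iff dest: spec[of _ 0])
    have "((\<lambda>y. f y * of_real (Re (q y)) - \<i> * (f y * of_real (Im (q y)))) has_integral 0 - \<i> * 0) ?I"
      by (intro has_integral_diff has_integral_mult_right i1 i2)
    moreover have "f y * of_real (Re (q y)) - \<i> * (f y * of_real (Im (q y))) = f y * cnj (q y)" for y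
      by (simp add: complex_eq_iff algebra_simps)
    ultimately have "((\<lambda>y. f y * cnj (q y)) has_integral 0) ?I" by simp
    from has_integral_linear[OF this bounded_linear_Re]
    have i3: "((\<lambda>y. Re (f y * cnj (q y))) has_integral 0) ?I" by (simp add: o_def)
    have "((\<lambda>y. (cmod (f y))\<^sup>2 - Re (f y * cnj (q y))) has_integral integral ?I (\<lambda>y. (cmod (f y))\<^sup>2) - 0) ?I"
      by (intro has_integral_diff i3 integrable_integral intf)
    moreover have "((\<lambda>y. e) has_integral e) ?I"
      using has_integral_const_real[of e 0 1] by simp
    moreover have "(cmod (f y))\<^sup>2 - Re (f y * cnj (q y)) \<le> e" if "y \<in> ?I" for y
    proof -
      have "(cmod (f y))\<^sup>2 - Re (f y * cnj (q y)) = Re (f y * cnj (f y - q y))"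
        unfolding cmod_power2 by (simp add: algebra_simps power2_eq_square)
      also have "\<dots> \<le> cmod (f y) * cmod (f y - q y)"
        by (metis complex_Re_le_cmod complex_mod_cnj norm_mult)
      also have "\<dots> \<le> B * (e / B)"
        using B that p(2)[of "fexp 1 y"] by (intro mult_mono) (auto simp: g q_def)
      finally show ?thesis using B by simp
    qed
    ultimately have "integral ?I (\<lambda>y. (cmod (f y))\<^sup>2) - 0 \<le> e"
      by (rule has_integral_le)
    then show "integral ?I (\<lambda>y. (cmod (f y))\<^sup>2) \<le> 0 + e" by simp
  qed
  moreover have "0 \<le> integral ?I (\<lambda>y. (cmod (f y))\<^sup>2)"
    by (intro integral_nonneg intf) auto
  ultimately have "((\<lambda>y. (cmod (f y))\<^sup>2) has_integral 0) (cbox 0 1)"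
    using intf by (simp add: has_integral_iff)
  moreover have "continuous_on (cbox 0 1) (\<lambda>y. (cmod (f y))\<^sup>2)"
    by (intro continuous_intros continuous_on_subset[OF cont] subset_UNIV)
  ultimately have "(cmod (f y))\<^sup>2 = 0" if "y \<in> ?I" for y
    using has_integral_0_cbox_imp_0[of 0 1 "\<lambda>y. (cmod (f y))\<^sup>2" y] that by simp
  moreover obtain x where "x \<in> ?I" "fexp 1 x = fexp 1 y" using surj[of "fexp 1 y"] by auto
  ultimately show ?thesis using wd by (metis norm_eq_zero power_eq_0_iff)
qed


subsection \<open>The complex Banach space \<open>H\<^sup>1\<^sup>,\<^sup>+\<^sub>0\<close>\<close>

typedef hardy = H1_plus0
proof
  show "(\<lambda>_. 0) \<in> H1_plus0"
    by (simp add: H1_plus0_def H1_def fourier_def)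
qed

setup_lifting type_definition_hardy

abbreviation hcoeff :: "hardy \<Rightarrow> int \<Rightarrow> complex"
  where "hcoeff f \<equiv> fourier (Rep_hardy f)"

lemma hcoeff_wsq: "wsq (hcoeff f) summable_on UNIV"
  using Rep_hardy[of f] by (simp add: H1_plus0_def H1_def wsq_def[abs_def])

lemma hardy_cont: "continuous_on UNIV (Rep_hardy f)"
  using Rep_hardy[of f] by (simp add: H1_plus0_def H1_def)

lemma H1_plus0_add:
  assumes "f \<in> H1_plus0" "g \<in> H1_plus0"
  shows "(\<lambda>y. f y + g y) \<in> H1_plus0"
proof -
  have "fourier (\<lambda>y. f y + g y) = (\<lambda>k. fourier f k + fourier g k)"
    using assms by (auto simp: H1_plus0_def H1_def fourier_add)
  then show ?thesis
    using assms wsq_summable_add[of "fourier f" "fourier g"]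
    by (auto simp: H1_plus0_def H1_def wsq_def[abs_def] intro!: continuous_intros)
qed

lemma H1_plus0_scale:
  assumes "f \<in> H1_plus0"
  shows "(\<lambda>y. c * f y) \<in> H1_plus0"
  using assms wsq_summable_scale[of "fourier f" c]
  by (auto simp: H1_plus0_def H1_def wsq_def[abs_def] fourier_scale intro!: continuous_intros)

instantiation hardy :: complex_normed_vector
begin

lift_definition zero_hardy :: hardy is "\<lambda>_. 0"
  by (simp add: H1_plus0_def H1_def fourier_def)
lift_definition plus_hardy :: "hardy \<Rightarrow> hardy \<Rightarrow> hardy" is "\<lambda>f g y. f y + g y"
  by (rule H1_plus0_add)
lift_definition scaleC_hardy :: "complex \<Rightarrow> hardy \<Rightarrow> hardy" is "\<lambda>c f y. c * f y"
  by (rule H1_plus0_scale)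
definition uminus_hardy :: "hardy \<Rightarrow> hardy" where "- f = (- 1) *\<^sub>C f" for f :: hardy
definition minus_hardy :: "hardy \<Rightarrow> hardy \<Rightarrow> hardy" where "f - g = f + (- 1) *\<^sub>C g" for f g :: hardy
definition scaleR_hardy :: "real \<Rightarrow> hardy \<Rightarrow> hardy" where "r *\<^sub>R f = of_real r *\<^sub>C f" for f :: hardy
definition norm_hardy :: "hardy \<Rightarrow> real" where "norm f = H1_norm (Rep_hardy f)"
definition sgn_hardy :: "hardy \<Rightarrow> hardy" where "sgn f = inverse (norm f) *\<^sub>R f" for f :: hardy
definition dist_hardy :: "hardy \<Rightarrow> hardy \<Rightarrow> real" where "dist f g = norm (f - g)" for f g :: hardy
definition uniformity_hardy :: "(hardy \<times> hardy) filter"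
  where "uniformity_hardy = (INF e\<in>{0<..}. principal {(x, y). dist x y < e})"
definition open_hardy :: "hardy set \<Rightarrow> bool"
  where "open_hardy U \<longleftrightarrow> (\<forall>x\<in>U. \<forall>\<^sub>F (x', y) in uniformity. x' = x \<longrightarrow> y \<in> U)"

lemma norm_hardy_wsq: "norm f = sqrt (infsum (wsq (hcoeff f)) UNIV)"
  by (simp add: norm_hardy_def H1_norm_def wsq_def[abs_def])

lemma hcoeff_add: "hcoeff (f + g) k = hcoeff f k + hcoeff g k"
  by (simp add: plus_hardy.rep_eq fourier_add hardy_cont)

lemma hcoeff_scaleC: "hcoeff (c *\<^sub>C f) k = c * hcoeff f k"
  by (simp add: scaleC_hardy.rep_eq fourier_scale)

lemma hcoeff_zero: "hcoeff 0 k = 0"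
  by (simp add: zero_hardy.rep_eq fourier_def)

lemma hardy_eq_0I:
  assumes "\<And>k. hcoeff f k = 0"
  shows "f = 0"
proof -
  have "Rep_hardy f y = 0" for y
    using fourier_eq_0_imp_eq_0[of "Rep_hardy f" y] assms Rep_hardy[of f] by (auto simp: H1_plus0_def H1_def)
  then show ?thesis by (auto simp: zero_hardy.rep_eq simp flip: Rep_hardy_inject)
qed

instance
proof
  fix f g h :: hardy and c d :: complex and r s :: real
  show "f + g + h = f + (g + h)" by transfer (simp add: add.assoc)
  show "f + g = g + f" by transfer (simp add: add.commute)
  show "0 + f = f" by transfer simp
  show "- f + f = 0" unfolding uminus_hardy_def by transfer simp
  show "f - g = f + - g" by (simp add: minus_hardy_def uminus_hardy_def)
  show "c *\<^sub>C (f + g) = c *\<^sub>C f + c *\<^sub>C g" by transfer (simp add: distrib_left)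
  show "(c + d) *\<^sub>C f = c *\<^sub>C f + d *\<^sub>C f" by transfer (simp add: distrib_right)
  show "c *\<^sub>C d *\<^sub>C f = (c * d) *\<^sub>C f" by transfer (simp add: mult.assoc)
  show "of_real r *\<^sub>C f = r *\<^sub>R f" by (simp add: scaleR_hardy_def)
  show "r *\<^sub>R (f + g) = r *\<^sub>R f + r *\<^sub>R g" unfolding scaleR_hardy_def by transfer (simp add: distrib_left)
  show "(r + s) *\<^sub>R f = r *\<^sub>R f + s *\<^sub>R f" unfolding scaleR_hardy_def by transfer (simp add: distrib_right)
  show "r *\<^sub>R s *\<^sub>R f = (r * s) *\<^sub>R f" unfolding scaleR_hardy_def by transfer (simp add: mult.assoc)
  show "1 *\<^sub>R f = f" unfolding scaleR_hardy_def by transfer simp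
  show nC: "norm (c *\<^sub>C f) = cmod c * norm f" for c and f :: hardy
    by (simp add: norm_hardy_wsq hcoeff_scaleC[abs_def] wsq_scale[abs_def] infsum_cmult_right' real_sqrt_mult)
  show "norm (r *\<^sub>R f) = \<bar>r\<bar> * norm f" by (simp add: scaleR_hardy_def nC)
  show "norm (f + g) \<le> norm f + norm g"
    by (simp add: norm_hardy_wsq hcoeff_add[abs_def] wsq_triangle hcoeff_wsq)
  show "norm f = 0 \<longleftrightarrow> f = 0"
  proof
    assume "norm f = 0"
    then have "infsum (wsq (hcoeff f)) UNIV = 0" by (simp add: norm_hardy_wsq)
    then have "wsq (hcoeff f) k = 0" for k
      using nonneg_infsum_le_0D[of "wsq (hcoeff f)" UNIV k] hcoeff_wsq[of f] by simp
    then have "hcoeff f k = 0" for k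
      using norm_sq_le_wsq[of "hcoeff f" k] by simp
    then show "f = 0" by (rule hardy_eq_0I)
  qed (simp add: norm_hardy_wsq wsq_def[abs_def] hcoeff_zero)
qed (auto simp: sgn_hardy_def dist_hardy_def uniformity_hardy_def open_hardy_def)

end

lemma hcoeff_diff: "hcoeff (f - g) k = hcoeff f k - hcoeff g k"
  by (simp add: minus_hardy_def hcoeff_add hcoeff_scaleC)

lemma norm_hcoeff_le: "cmod (hcoeff f k) \<le> norm f"
proof -
  have "(cmod (hcoeff f k))\<^sup>2 \<le> sum (wsq (hcoeff f)) {k}" by (simp add: norm_sq_le_wsq)
  also have "\<dots> \<le> infsum (wsq (hcoeff f)) UNIV"
    by (rule finite_sum_le_infsum[OF hcoeff_wsq]) auto
  finally show ?thesis by (simp add: norm_hardy_wsq real_le_rsqrt)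
qed

lemma hardy_of_coeffs:
  assumes "wsq a summable_on UNIV" "\<And>k. k \<le> 0 \<Longrightarrow> a k = 0"
  obtains f where "hcoeff f = a"
proof -
  note * = fourier_series[OF wsq_summable_imp_abs_summable[OF assms(1)]]
  define g where "g = (\<lambda>y. \<Sum>\<^sub>\<infinity>k. a k * fexp k y)"
  have "fourier g = a" "continuous_on UNIV g" "\<And>y. g (y + 1) = g y"
    using * by (auto simp: g_def)
  then have "g \<in> H1_plus0"
    using assms by (auto simp: H1_plus0_def H1_def wsq_def[abs_def])
  then show ?thesis using that[of "Abs_hardy g"] \<open>fourier g = a\<close> by (simp add: Abs_hardy_inverse)
qed

instance hardy :: complex_banach
proof
  fix X :: "nat \<Rightarrow> hardy" assume X: "Cauchy X"
  have "Cauchy (\<lambda>n. hcoeff (X n) k)" for k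
  proof (rule metric_CauchyI)
    fix e :: real assume "0 < e"
    then obtain M where "\<forall>m\<ge>M. \<forall>n\<ge>M. dist (X m) (X n) < e" using X by (meson metric_CauchyD)
    moreover have "dist (hcoeff (X m) k) (hcoeff (X n) k) \<le> dist (X m) (X n)" for m n
      using norm_hcoeff_le[of "X m - X n" k] by (simp add: dist_norm hcoeff_diff)
    ultimately show "\<exists>M. \<forall>m\<ge>M. \<forall>n\<ge>M. dist (hcoeff (X m) k) (hcoeff (X n) k) < e"
      by (meson le_less_trans)
  qed
  then have "\<exists>l. (\<lambda>n. hcoeff (X n) k) \<longlonglongrightarrow> l" for k
    using Cauchy_convergent convergent_def by blast
  then obtain a where a: "\<And>k. (\<lambda>n. hcoeff (X n) k) \<longlonglongrightarrow> a k" by metis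
  have bound: "\<exists>M. \<forall>n\<ge>M. \<forall>F. finite F \<longrightarrow> sum (wsq (\<lambda>k. hcoeff (X n) k - a k)) F \<le> e\<^sup>2" if "0 < e" for e
  proof -
    obtain M where M: "\<And>m n. m \<ge> M \<Longrightarrow> n \<ge> M \<Longrightarrow> norm (X n - X m) < e"
      using X \<open>0 < e\<close> by (metis metric_CauchyD dist_norm)
    have "sum (wsq (\<lambda>k. hcoeff (X n) k - a k)) F \<le> e\<^sup>2" if "n \<ge> M" "finite F" for n F
    proof (rule tendsto_upperbound)
      show "((\<lambda>m. sum (wsq (\<lambda>k. hcoeff (X n) k - hcoeff (X m) k)) F) \<longlongrightarrow> sum (wsq (\<lambda>k. hcoeff (X n) k - a k)) F) sequentially"
        unfolding wsq_def by (intro tendsto_intros a)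
      have "sum (wsq (\<lambda>k. hcoeff (X n) k - hcoeff (X m) k)) F \<le> e\<^sup>2" if "m \<ge> M" for m
      proof -
        have "sum (wsq (hcoeff (X n - X m))) F \<le> infsum (wsq (hcoeff (X n - X m))) UNIV"
          by (rule finite_sum_le_infsum[OF hcoeff_wsq \<open>finite F\<close>]) auto
        also have "\<dots> = (norm (X n - X m))\<^sup>2"
          by (simp add: norm_hardy_wsq infsum_nonneg)
        also have "\<dots> \<le> e\<^sup>2"
          using M[OF \<open>m \<ge> M\<close> \<open>n \<ge> M\<close>] by (intro power_mono) auto
        finally show ?thesis by (simp add: hcoeff_diff[abs_def])
      qed
      then show "\<forall>\<^sub>F m in sequentially. sum (wsq (\<lambda>k. hcoeff (X n) k - hcoeff (X m) k)) F \<le> e\<^sup>2"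
        by (auto simp: eventually_sequentially)
    qed simp
    then show ?thesis by blast
  qed
  have summ: "wsq (\<lambda>k. hcoeff (X n) k - a k) summable_on UNIV"
    if "\<And>F. finite F \<Longrightarrow> sum (wsq (\<lambda>k. hcoeff (X n) k - a k)) F \<le> C" for n C
    by (rule nonneg_bdd_above_summable_on) (use that in \<open>auto intro!: bdd_aboveI2\<close>)
  obtain N where "\<And>F. finite F \<Longrightarrow> sum (wsq (\<lambda>k. hcoeff (X N) k - a k)) F \<le> 1\<^sup>2"
    using bound[of 1] by (metis order_refl zero_less_one)
  then have "wsq (\<lambda>k. hcoeff (X N) k - a k) summable_on UNIV" by (rule summ)
  from wsq_summable_add[OF hcoeff_wsq[of "X N"] wsq_summable_scale[OF this, of "- 1"]]
  have "wsq a summable_on UNIV" by simp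
  moreover have "a k = 0" if "k \<le> 0" for k
  proof -
    have "hcoeff (X n) k = 0" for n using Rep_hardy[of "X n"] that by (simp add: H1_plus0_def)
    with a[of k] show ?thesis by (simp add: LIMSEQ_const_iff)
  qed
  ultimately obtain f where f: "hcoeff f = a" by (rule hardy_of_coeffs)
  have "X \<longlonglongrightarrow> f"
  proof (rule LIMSEQ_I)
    fix e :: real assume "0 < e"
    then obtain M where M: "\<And>n F. n \<ge> M \<Longrightarrow> finite F \<Longrightarrow> sum (wsq (\<lambda>k. hcoeff (X n) k - a k)) F \<le> (e / 2)\<^sup>2"
      using bound[of "e / 2"] by auto
    have "norm (X n - f) < e" if "n \<ge> M" for n
    proof -
      have "infsum (wsq (hcoeff (X n - f))) UNIV \<le> (e / 2)\<^sup>2"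
        by (rule infsum_le_finite_sums[OF hcoeff_wsq]) (use M[OF that] in \<open>auto simp: hcoeff_diff[abs_def] f\<close>)
      then have "norm (X n - f) \<le> e / 2"
        unfolding norm_hardy_wsq using \<open>0 < e\<close> by (intro real_le_lsqrt) auto
      with \<open>0 < e\<close> show ?thesis by simp
    qed
    then show "\<exists>M. \<forall>n\<ge>M. norm (X n - f) < e" by blast
  qed
  then show "convergent X" by (rule convergentI)
qed


section \<open>The Hamiltonians \<open>I\<^sub>k\<close>\<close>

definition Pi_plus :: "(real \<Rightarrow> complex) \<Rightarrow> real \<Rightarrow> complex"
  where "Pi_plus f y = (\<Sum>\<^sub>\<infinity>k\<in>{0..}. fourier f k * fexp k y)"

definition Pi_plus0 :: "(real \<Rightarrow> complex) \<Rightarrow> real \<Rightarrow> complex"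
  where "Pi_plus0 f y = (\<Sum>\<^sub>\<infinity>k\<in>{1..}. fourier f k * fexp k y)"

definition pairing :: "(real \<Rightarrow> complex) \<Rightarrow> (real \<Rightarrow> complex) \<Rightarrow> complex"
  where "pairing f g = (\<Sum>\<^sub>\<infinity>k. fourier f k * fourier g k)"

definition Lop :: "(real \<Rightarrow> complex) \<Rightarrow> real \<Rightarrow> complex"
  where "Lop f y = f y * fexp (- 1) y"

definition A_op :: "nat \<Rightarrow> (real \<Rightarrow> complex) \<Rightarrow> (real \<Rightarrow> complex) \<Rightarrow> real \<Rightarrow> complex"
  where "A_op k w g y = g y * Pi_plus ((Lop ^^ (k + 1)) w) y - w y * Pi_plus ((Lop ^^ (k + 1)) g) y"

definition Gamma_op :: "(real \<Rightarrow> complex) \<Rightarrow> (real \<Rightarrow> complex) \<Rightarrow> real \<Rightarrow> complex"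
  where "Gamma_op w p = Pi_plus0 (\<lambda>y. w y * p (- y))"

definition I_fun :: "nat \<Rightarrow> hardy \<times> hardy \<Rightarrow> complex"
  where "I_fun k = (\<lambda>(w, p). pairing
    (A_op k (Rep_hardy w) (Gamma_op (Rep_hardy w) (Rep_hardy p))) (Rep_hardy p))"


section \<open>Gradients and Hamiltonian vector fields\<close>

text \<open>A distribution on the torus is given by its sequence of Fourier coefficients; the sequences
  that occur are exactly those of polynomial growth.\<close>

definition distribution_coeffs :: "(int \<Rightarrow> complex) set"
  where "distribution_coeffs = {u. \<exists>C N. \<forall>k. cmod (u k) \<le> C * jap k ^ N}"

definition is_gradient :: "(hardy \<Rightarrow> complex) \<Rightarrow> (int \<Rightarrow> complex) \<Rightarrow> bool"
  where "is_gradient D u \<longleftrightarrow> u \<in> distribution_coeffs \<and> (\<forall>k\<le>0. u k = 0) \<and>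
    (\<forall>h. ((\<lambda>k. u k * hcoeff h k) has_sum D h) UNIV)"

definition D1 :: "(hardy \<times> hardy \<Rightarrow> complex) \<Rightarrow> hardy \<times> hardy \<Rightarrow> hardy \<Rightarrow> complex"
  where "D1 F = (\<lambda>(w, p). frechet_derivative (\<lambda>w'. F (w', p)) (at w))"

definition D2 :: "(hardy \<times> hardy \<Rightarrow> complex) \<Rightarrow> hardy \<times> hardy \<Rightarrow> hardy \<Rightarrow> complex"
  where "D2 F = (\<lambda>(w, p). frechet_derivative (\<lambda>p'. F (w, p')) (at p))"

definition grad_w :: "(hardy \<times> hardy \<Rightarrow> complex) \<Rightarrow> hardy \<times> hardy \<Rightarrow> int \<Rightarrow> complex"
  where "grad_w F x = (THE u. is_gradient (D1 F x) u)"

definition grad_p :: "(hardy \<times> hardy \<Rightarrow> complex) \<Rightarrow> hardy \<times> hardy \<Rightarrow> int \<Rightarrow> complex"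
  where "grad_p F x = (THE u. is_gradient (D2 F x) u)"

text \<open>The gradients are well defined: they exist as distributions and belong to \<open>H\<^sup>1\<^sup>,\<^sup>+\<^sub>0\<close>, which
  is embedded into the distributions by \<^term>\<open>hcoeff\<close>.\<close>

definition hamiltonian_well_defined :: "(hardy \<times> hardy \<Rightarrow> complex) \<Rightarrow> bool"
  where "hamiltonian_well_defined F \<longleftrightarrow> C1_map F \<and>
    (\<forall>x. is_gradient (D1 F x) (grad_w F x) \<and> grad_w F x \<in> range (\<lambda>f. hcoeff f) \<and>
         is_gradient (D2 F x) (grad_p F x) \<and> grad_p F x \<in> range (\<lambda>f. hcoeff f))"

definition hamiltonian_field :: "(hardy \<times> hardy \<Rightarrow> complex) \<Rightarrow> hardy \<times> hardy \<Rightarrow> hardy \<times> hardy"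
  where "hamiltonian_field F x =
    ((THE f. hcoeff f = grad_p F x), - (THE f. hcoeff f = grad_w F x))"

lemma hcoeff_inject: "hcoeff f = hcoeff g \<longleftrightarrow> f = g"
  using hardy_eq_0I[of "f - g"] by (auto simp: hcoeff_diff)

lemma is_gradient_unique:
  assumes u: "is_gradient D u" and v: "is_gradient D v"
  shows "u = v"
proof
  fix k
  show "u k = v k"
  proof (cases "k \<le> 0")
    case True
    then show ?thesis using assms by (simp add: is_gradient_def)
  next
    case False
    define a where "a j = (if j = k then 1 else 0 :: complex)" for j
    have "wsq a summable_on UNIV"
      by (rule finite_nonzero_values_imp_summable_on, rule finite_subset[of _ "{k}"]) (auto simp: a_def wsq_def)
    then obtain h where h: "hcoeff h = a"
      by (rule hardy_of_coeffs) (use False in \<open>auto simp: a_def\<close>)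
    have "D h = w k" if "is_gradient D w" for w
    proof (rule has_sum_unique)
      show "((\<lambda>j. w j * hcoeff h j) has_sum D h) UNIV"
        using that by (simp add: is_gradient_def)
      show "((\<lambda>j. w j * hcoeff h j) has_sum w k) UNIV"
        by (rule has_sum_finite_neutralI[of "{k}"]) (auto simp: h a_def)
    qed
    with assms show ?thesis by metis
  qed
qed

end

theory Submission
  imports Defs
begin

text \<open>With \<open>M\<close> the multiplication of \<open>H\<^sup>1\<^sup>,\<^sup>+\<^sub>0\<close>, \<open>S\<close> the truncated left shift and \<open>R\<close> the right shift,
  one has \<open>A\<^sub>k(w)g = S (M(g, S\<^sup>k w) - M(w, S\<^sup>k g))\<close>. For the bilinear pairing, \<open>R\<close> is the transpose
  of \<open>S\<close> and the truncated product \<open>\<Gamma>(\<cdot>)a\<close> is the transpose of \<open>M(a, \<cdot>)\<close>, and all of these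
  operators are bounded because weighted square-summable sequences form a convolution algebra. Hence
  \<open>I\<^sub>k(w, p) = \<langle>\<Gamma>(w)p, N(w, p)\<rangle>\<close> with \<open>N(w, p)\<close> the transpose of \<open>A\<^sub>k(w)\<close> applied to \<open>p\<close>, and
  transposing once more the terms of the differential shows that both gradients are bounded cubic
  polynomials with values in \<open>H\<^sup>1\<^sup>,\<^sup>+\<^sub>0\<close>.\<close>


section \<open>Convolution of weighted sequences\<close>

definition wnorm :: "(int \<Rightarrow> complex) \<Rightarrow> real"
  where "wnorm a = sqrt (infsum (wsq a) UNIV)"

definition conv :: "(int \<Rightarrow> complex) \<Rightarrow> (int \<Rightarrow> complex) \<Rightarrow> int \<Rightarrow> complex"
  where "conv a b n = (\<Sum>\<^sub>\<infinity>m. a m * b (n - m))"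

text \<open>The Cauchy-Schwarz constant of the embedding of weighted square-summable sequences into
  \<ell>1.\<close>

definition jap_const :: real
  where "jap_const = sqrt (\<Sum>\<^sub>\<infinity>k. inverse ((jap k)\<^sup>2))"

lemma wnorm_nonneg [simp]: "0 \<le> wnorm a"
  by (simp add: wnorm_def infsum_nonneg)

lemma jap_const_nonneg [simp]: "0 \<le> jap_const"
  by (simp add: jap_const_def infsum_nonneg)

lemma jap_triangle: "jap n \<le> jap m + jap (n - m)"
  by (auto simp: jap_def)

lemma bij_int_diff: "bij_betw (\<lambda>m. n - m) UNIV (UNIV :: int set)"
  by (rule bij_betwI[where g = "\<lambda>m. n - m"]) auto

lemma L2_set_le_wnorm:
  assumes "wsq a summable_on UNIV" "finite F"
  shows "L2_set (\<lambda>k. cmod (a k) * jap k) F \<le> wnorm a"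
proof -
  have "(\<Sum>k\<in>F. wsq a k) \<le> infsum (wsq a) UNIV"
    by (rule finite_sum_le_infsum[OF assms]) auto
  then show ?thesis
    by (simp add: L2_set_def wsq_def power_mult_distrib wnorm_def)
qed

text \<open>Norms are estimated on finite index sets, where Minkowski and Cauchy-Schwarz are
  available for \<open>L2_set\<close>; this passes to all of the integers by monotone
  limits.\<close>

lemma wnorm_leI:
  assumes "\<And>F. finite F \<Longrightarrow> L2_set (\<lambda>k. cmod (a k) * jap k) F \<le> C"
  shows "wsq a summable_on UNIV" "wnorm a \<le> C"
proof -
  have C: "0 \<le> C" using assms[of "{}"] by simp
  have *: "sum (wsq a) F \<le> C\<^sup>2" if "finite F" for F
    using sqrt_le_D[OF assms[OF that, unfolded L2_set_def]]
    by (simp add: wsq_def power_mult_distrib)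
  show s: "wsq a summable_on UNIV"
    by (rule nonneg_bdd_above_summable_on) (use * in \<open>auto intro!: bdd_aboveI2\<close>)
  have "infsum (wsq a) UNIV \<le> C\<^sup>2"
    by (rule infsum_le_finite_sums[OF s]) (use * in auto)
  then show "wnorm a \<le> C"
    unfolding wnorm_def using C by (intro real_le_lsqrt)
qed

text \<open>Cauchy-Schwarz for the factorisation of \<open>cmod (a k)\<close> into
  \<open>cmod (a k) * jap k\<close> and \<open>inverse (jap k)\<close>.\<close>

lemma infsum_cmod_le_wnorm:
  assumes "wsq a summable_on UNIV"
  shows "(\<Sum>\<^sub>\<infinity>k. cmod (a k)) \<le> jap_const * wnorm a"
proof (rule infsum_le_finite_sums[OF wsq_summable_imp_abs_summable[OF assms]])
  fix F :: "int set" assume F: "finite F"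
  have "(\<Sum>k\<in>F. cmod (a k)) = (\<Sum>k\<in>F. \<bar>cmod (a k) * jap k\<bar> * \<bar>inverse (jap k)\<bar>)"
  proof (rule sum.cong[OF refl])
    fix k show "cmod (a k) = \<bar>cmod (a k) * jap k\<bar> * \<bar>inverse (jap k)\<bar>"
      using jap_ge_1[of k] by (simp add: abs_mult)
  qed
  also have "\<dots> \<le> L2_set (\<lambda>k. cmod (a k) * jap k) F * L2_set (\<lambda>k. inverse (jap k)) F"
    by (rule L2_set_mult_ineq)
  also have "\<dots> \<le> wnorm a * jap_const"
  proof (intro mult_mono L2_set_le_wnorm[OF assms F])
    have "(\<Sum>k\<in>F. inverse ((jap k)\<^sup>2)) \<le> (\<Sum>\<^sub>\<infinity>k. inverse ((jap k)\<^sup>2))"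
      by (rule finite_sum_le_infsum[OF summable_inverse_jap_sq F]) auto
    then show "L2_set (\<lambda>k. inverse (jap k)) F \<le> jap_const"
      by (simp add: L2_set_def jap_const_def power_inverse)
  qed auto
  finally show "(\<Sum>k\<in>F. cmod (a k)) \<le> jap_const * wnorm a" by (simp add: mult.commute)
qed

lemma L2_set_sum_le:
  assumes "finite G"
  shows "L2_set (\<lambda>n. \<Sum>m\<in>G. f m n) F \<le> (\<Sum>m\<in>G. L2_set (f m) F)"
  using assms
proof (induction G rule: finite_induct)
  case (insert m G)
  then show ?case
    using L2_set_triangle_ineq[of "f m" "\<lambda>n. \<Sum>m\<in>G. f m n" F] by simp
qed (simp add: L2_set_def)

text \<open>Young's inequality for \<ell>1 against \<ell>2: the convolution is a superposition of
  translates of \<open>v\<close> with weights \<open>u m\<close>, each translate has \<ell>2 norm at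
  most \<open>V\<close>, and Minkowski adds them up.\<close>

lemma young_L2_set:
  fixes u :: "int \<Rightarrow> real"
  assumes u: "u summable_on UNIV" "\<And>m. 0 \<le> u m"
    and v: "\<And>F. finite F \<Longrightarrow> L2_set v F \<le> V" "\<And>m. 0 \<le> v m"
    and F: "finite F"
  shows "(\<lambda>m. u m * v (n - m)) summable_on UNIV"
    and "L2_set (\<lambda>n. \<Sum>\<^sub>\<infinity>m. u m * v (n - m)) F \<le> infsum u UNIV * V"
proof -
  have V: "v m \<le> V" for m
    using v(1)[of "{m}"] v(2)[of m] by simp
  show s: "(\<lambda>m. u m * v (n - m)) summable_on UNIV" for n
    by (rule summable_on_comparison_test[OF summable_on_cmult_left[OF u(1), of V]])
      (auto intro!: mult_left_mono mult_nonneg_nonneg u v V)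
  have V0: "0 \<le> V" using v(1)[of "{}"] by simp
  have fin: "L2_set (\<lambda>n. \<Sum>m\<in>G. u m * v (n - m)) F \<le> infsum u UNIV * V" if G: "finite G" for G
  proof -
    have "L2_set (\<lambda>n. u m * v (n - m)) F \<le> u m * V" for m
    proof -
      \<comment> \<open>A translate of \<open>v\<close> on the window \<open>F\<close> is
        \<open>v\<close> on a translated window, so the bound on \<open>v\<close> is used for a set
        other than \<open>F\<close>.\<close>
      have "L2_set (\<lambda>n. v (n - m)) F = L2_set v ((\<lambda>n. n - m) ` F)"
        unfolding L2_set_def by (subst sum.reindex) (auto simp: inj_on_def)
      also have "\<dots> \<le> V" using F by (intro v) auto
      finally have "u m * L2_set (\<lambda>n. v (n - m)) F \<le> u m * V"
        by (intro mult_left_mono u)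
      then show ?thesis using u(2)[of m] by (simp add: L2_set_right_distrib)
    qed
    then have "L2_set (\<lambda>n. \<Sum>m\<in>G. u m * v (n - m)) F \<le> (\<Sum>m\<in>G. u m * V)"
      by (intro order.trans[OF L2_set_sum_le[OF G]] sum_mono)
    also have "\<dots> = sum u G * V" by (simp add: sum_distrib_right)
    also have "\<dots> \<le> infsum u UNIV * V"
      by (intro mult_right_mono V0 finite_sum_le_infsum[OF u(1) G]) (auto intro: u)
    finally show ?thesis .
  qed
  \<comment> \<open>\<open>F\<close> is finite, so convergence of the partial sums at each
    \<open>n\<close> is enough to pass to the limit over \<open>G\<close>.\<close>
  have "((\<lambda>G. L2_set (\<lambda>n. \<Sum>m\<in>G. u m * v (n - m)) F) \<longlongrightarrow> L2_set (\<lambda>n. \<Sum>\<^sub>\<infinity>m. u m * v (n - m)) F) (finite_subsets_at_top UNIV)"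
    unfolding L2_set_def by (intro tendsto_intros infsum_tendsto s)
  then show "L2_set (\<lambda>n. \<Sum>\<^sub>\<infinity>m. u m * v (n - m)) F \<le> infsum u UNIV * V"
    by (rule tendsto_upperbound) (use fin in \<open>auto intro!: eventually_finite_subsets_at_top_weakI\<close>)
qed

lemma infsum_int_diff: "(\<Sum>\<^sub>\<infinity>m. f (n - m)) = infsum f (UNIV :: int set)"
  by (rule infsum_reindex_bij_betw[OF bij_int_diff])

text \<open>The weight is subadditive, so a weighted convolution splits into two convolutions of an
  \<open>\<ell>\<^sup>1\<close> with an \<open>\<ell>\<^sup>2\<close> sequence.\<close>

lemma wsq_conv:
  assumes a: "wsq a summable_on UNIV" and b: "wsq b summable_on UNIV"
  shows "wsq (conv a b) summable_on UNIV"
    and "wnorm (conv a b) \<le> 2 * jap_const * wnorm a * wnorm b"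
proof -
  have "L2_set (\<lambda>n. cmod (conv a b n) * jap n) F \<le> 2 * jap_const * wnorm a * wnorm b" if F: "finite F" for F
  proof -
    define A where "A k = cmod (a k)" for k
    define B where "B k = cmod (b k)" for k
    define c1 where "c1 n = (\<Sum>\<^sub>\<infinity>m. A m * (B (n - m) * jap (n - m)))" for n
    \<comment> \<open>The weight falls on \<open>A\<close> here; \<open>m\<close> and
      \<open>n - m\<close> are exchanged so that \<open>young_L2_set\<close> applies with
      \<open>B\<close> as the summable factor.\<close>
    define c2 where "c2 n = (\<Sum>\<^sub>\<infinity>m. B m * (A (n - m) * jap (n - m)))" for n
    have sA: "A summable_on UNIV" and sB: "B summable_on UNIV"
      unfolding A_def B_def by (intro wsq_summable_imp_abs_summable assms)+
    have j0: "0 \<le> jap k" for k using jap_ge_1[of k] by simp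
    have lA: "L2_set (\<lambda>k. A k * jap k) F \<le> wnorm a" and lB: "L2_set (\<lambda>k. B k * jap k) F \<le> wnorm b"
      if "finite F" for F
      unfolding A_def B_def using that a b by (auto intro: L2_set_le_wnorm)
    have nn: "0 \<le> A k" "0 \<le> B k" "0 \<le> A k * jap k" "0 \<le> B k * jap k" for k
      using j0[of k] by (auto simp: A_def B_def)
    note y1 = young_L2_set[OF sA nn(1) lB nn(4) F] and y2 = young_L2_set[OF sB nn(2) lA nn(3) F]
    have s2: "(\<lambda>m. B (n - m) * (A m * jap m)) summable_on UNIV" for n
      using summable_on_reindex_bij_betw[OF bij_int_diff, of "\<lambda>m. B m * (A (n - m) * jap (n - m))" n] y2(1)[of n]
      by simp
    have c2: "c2 n = (\<Sum>\<^sub>\<infinity>m. B (n - m) * (A m * jap m))" for n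
      using infsum_int_diff[of "\<lambda>m. B m * (A (n - m) * jap (n - m))" n] by (simp add: c2_def)
    have le: "cmod (conv a b n) * jap n \<le> c1 n + c2 n" for n
    proof -
      have j1: "A m * B (n - m) * jap n \<le> A m * (B (n - m) * jap (n - m)) + B (n - m) * (A m * jap m)" for m
        using mult_left_mono[OF jap_triangle[of n m], of "A m * B (n - m)"] nn(1)[of m] nn(2)[of "n - m"]
        by (simp add: algebra_simps)
      have ss: "(\<lambda>m. A m * (B (n - m) * jap (n - m)) + B (n - m) * (A m * jap m)) summable_on UNIV"
        by (intro summable_on_add y1 s2)
      have s3: "(\<lambda>m. A m * B (n - m) * jap n) summable_on UNIV"
        by (rule summable_on_comparison_test[OF ss]) (use j1 nn j0 in auto)
      \<comment> \<open>Dividing by the positive weight \<open>jap n\<close> recovers summability of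
        the unweighted terms.\<close>
      have "(\<lambda>m. inverse (jap n) * (A m * B (n - m) * jap n)) summable_on UNIV"
        by (intro summable_on_cmult_right s3)
      then have s4: "(\<lambda>m. A m * B (n - m)) summable_on UNIV"
        using jap_ge_1[of n] by (simp add: field_simps)
      have "cmod (conv a b n) \<le> (\<Sum>\<^sub>\<infinity>m. A m * B (n - m))"
        unfolding conv_def using norm_infsum_bound[of "\<lambda>m. a m * b (n - m)" UNIV] s4
        by (simp add: norm_mult A_def B_def)
      then have "cmod (conv a b n) * jap n \<le> (\<Sum>\<^sub>\<infinity>m. A m * B (n - m)) * jap n"
        by (intro mult_right_mono j0)
      also have "\<dots> = (\<Sum>\<^sub>\<infinity>m. A m * B (n - m) * jap n)"
        by (intro infsum_cmult_left[symmetric] s4)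
      also have "\<dots> \<le> (\<Sum>\<^sub>\<infinity>m. A m * (B (n - m) * jap (n - m)) + B (n - m) * (A m * jap m))"
        by (intro infsum_mono s3 ss j1)
      also have "\<dots> = c1 n + c2 n"
        unfolding c2 c1_def by (intro infsum_add y1 s2)
      finally show ?thesis .
    qed
    have "L2_set (\<lambda>n. cmod (conv a b n) * jap n) F \<le> L2_set (\<lambda>n. c1 n + c2 n) F"
      by (rule L2_set_mono) (use le j0 in auto)
    also have "\<dots> \<le> L2_set c1 F + L2_set c2 F" by (rule L2_set_triangle_ineq)
    also have "\<dots> \<le> infsum A UNIV * wnorm b + infsum B UNIV * wnorm a"
      unfolding c1_def c2_def by (intro add_mono y1 y2)
    also have "\<dots> \<le> (jap_const * wnorm a) * wnorm b + (jap_const * wnorm b) * wnorm a"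
      unfolding A_def B_def by (intro add_mono mult_right_mono infsum_cmod_le_wnorm assms) auto
    finally show ?thesis by (simp add: algebra_simps)
  qed
  note * = wnorm_leI[OF this]
  show "wsq (conv a b) summable_on UNIV" "wnorm (conv a b) \<le> 2 * jap_const * wnorm a * wnorm b"
    by (rule *; assumption)+
qed

text \<open>A common comparison principle for reflections, truncations and shifts:
  \<open>\<sigma>\<close> sends an index of \<open>a\<close> to the index of \<open>b\<close> that
  dominates it, and injectivity makes each term of \<open>b\<close> count at most once. Conditions
  are imposed on the support of \<open>a\<close> alone, which accommodates truncated
  sequences.\<close>

lemma wsq_dominated:
  assumes "wsq b summable_on UNIV" "0 \<le> C" "inj_on \<sigma> {k. a k \<noteq> 0}"
    and "\<And>k. a k \<noteq> 0 \<Longrightarrow> cmod (a k) * jap k \<le> C * (cmod (b (\<sigma> k)) * jap (\<sigma> k))"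
  shows "wsq a summable_on UNIV" "wnorm a \<le> C * wnorm b"
proof -
  have "L2_set (\<lambda>k. cmod (a k) * jap k) F \<le> C * wnorm b" if F: "finite F" for F
  proof -
    let ?F = "F \<inter> {k. a k \<noteq> 0}"
    have "L2_set (\<lambda>k. cmod (a k) * jap k) F = L2_set (\<lambda>k. cmod (a k) * jap k) ?F"
      unfolding L2_set_def by (rule arg_cong[where f = sqrt], rule sum.mono_neutral_right) (use F in auto)
    also have "\<dots> \<le> L2_set (\<lambda>k. C * (cmod (b (\<sigma> k)) * jap (\<sigma> k))) ?F"
      by (rule L2_set_mono) (use assms(4) jap_ge_1 order_trans[OF zero_le_one jap_ge_1] in auto)
    also have "\<dots> = C * L2_set (\<lambda>k. cmod (b (\<sigma> k)) * jap (\<sigma> k)) ?F"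
      by (simp add: L2_set_right_distrib assms)
    also have "L2_set (\<lambda>k. cmod (b (\<sigma> k)) * jap (\<sigma> k)) ?F = L2_set (\<lambda>k. cmod (b k) * jap k) (\<sigma> ` ?F)"
      unfolding L2_set_def by (subst sum.reindex[OF inj_on_subset[OF assms(3)]]) auto
    also have "C * \<dots> \<le> C * wnorm b"
      by (intro mult_left_mono L2_set_le_wnorm assms) (use F in auto)
    finally show ?thesis .
  qed
  note * = wnorm_leI[OF this]
  show "wsq a summable_on UNIV" "wnorm a \<le> C * wnorm b"
    by (rule *; assumption)+
qed

section \<open>Convolutions as absolutely convergent double series\<close>

lemma abs_summable_conv_pairs:
  fixes a b z :: "int \<Rightarrow> complex"
  assumes "(\<lambda>k. cmod (a k)) summable_on UNIV" "(\<lambda>k. cmod (b k)) summable_on UNIV" "\<And>k. cmod (z k) \<le> Z"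
  shows "(\<lambda>x. cmod (case x of (m, j) \<Rightarrow> a m * b j * z (m + j))) summable_on UNIV"
proof -
  have "(\<lambda>(m, j). cmod (a m) * cmod (b j)) summable_on UNIV \<times> UNIV"
    by (rule summable_on_SigmaI[where g = "\<lambda>m. cmod (a m) * (\<Sum>\<^sub>\<infinity>j. cmod (b j))"])
      (use assms in \<open>auto intro!: has_sum_cmult_right summable_on_cmult_left has_sum_infsum\<close>)
  from summable_on_cmult_left[OF this, of Z]
  have "(\<lambda>(m, j). cmod (a m) * cmod (b j) * Z) summable_on UNIV"
    by (simp add: case_prod_unfold)
  then show ?thesis
    by (rule summable_on_comparison_test)
      (auto simp: norm_mult intro!: mult_left_mono assms)
qed

lemma bij_conv_pairs: "bij_betw (\<lambda>(n, m). (m, n - m)) UNIV (UNIV :: (int \<times> int) set)"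
  by (rule bij_betwI[where g = "\<lambda>(m, j). (m + j, m)"]) auto

lemma summable_conv_terms:
  fixes a b :: "int \<Rightarrow> complex"
  assumes a: "(\<lambda>k. cmod (a k)) summable_on UNIV" and b: "(\<lambda>k. cmod (b k)) summable_on UNIV"
  shows "(\<lambda>m. a m * b (n - m)) summable_on UNIV"
proof -
  have "(\<lambda>(m, j). a m * b j * 1) summable_on UNIV"
    by (rule abs_summable_summable[OF abs_summable_conv_pairs[OF a b, where z = "\<lambda>_. 1" and Z = 1]]) simp
  then have "(\<lambda>(n, m). a m * b (n - m)) summable_on (Sigma UNIV (\<lambda>_. UNIV))"
    using summable_on_reindex_bij_betw[OF bij_conv_pairs, of "\<lambda>(m, j). a m * b j"]
    by (simp add: case_prod_unfold)
  then show ?thesis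
    using summable_on_SigmaD1[of "\<lambda>n m. a m * b (n - m)" UNIV "\<lambda>_. UNIV" n] by simp
qed

text \<open>Fubini after the change of variables \<open>j = n - m\<close>. The bounded sequence
  \<open>z\<close> is a test sequence: the constant 1 gives summability of the convolution, the
  characters \<open>fexp k y\<close> give the product of Fourier series, and the coefficients of a
  third Hardy function give the trilinear form behind the transposition rules.\<close>

lemma conv_has_sum:
  assumes a: "(\<lambda>k. cmod (a k)) summable_on UNIV" and b: "(\<lambda>k. cmod (b k)) summable_on UNIV"
    and z: "\<And>k. cmod (z k) \<le> Z"
  shows "((\<lambda>n. conv a b n * z n) has_sum (\<Sum>\<^sub>\<infinity>(m, j). a m * b j * z (m + j))) UNIV"
proof -
  have "(\<lambda>(m, j). a m * b j * z (m + j)) summable_on UNIV"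
    by (rule abs_summable_summable[OF abs_summable_conv_pairs[OF assms]])
  from has_sum_infsum[OF this] has_sum_reindex_bij_betw[OF bij_conv_pairs, of "\<lambda>(m, j). a m * b j * z (m + j)"]
  have 1: "((\<lambda>(n, m). a m * b (n - m) * z n) has_sum (\<Sum>\<^sub>\<infinity>(m, j). a m * b j * z (m + j))) (Sigma UNIV (\<lambda>_. UNIV))"
    by (simp add: case_prod_unfold)
  from summable_conv_terms[OF a b]
  have "((\<lambda>m. a m * b (n - m) * z n) has_sum (conv a b n * z n)) UNIV" for n
    unfolding conv_def by (intro has_sum_cmult_left has_sum_infsum)
  then show ?thesis
    by (intro has_sum_SigmaD[OF 1]) simp
qed

lemma abs_summable_conv:
  assumes a: "(\<lambda>k. cmod (a k)) summable_on UNIV" and b: "(\<lambda>k. cmod (b k)) summable_on UNIV"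
  shows "(\<lambda>n. cmod (conv a b n)) summable_on UNIV"
proof -
  have "(\<lambda>n. conv a b n * 1) summable_on UNIV"
    using conv_has_sum[OF a b, of "\<lambda>_. 1" 1] by (auto simp: summable_on_def)
  then show ?thesis
    \<comment> \<open>Unordered summability of a complex family is the same as absolute
      summability.\<close>
    by (simp add: summable_on_iff_abs_summable_on_complex)
qed


section \<open>Absolutely convergent Fourier series\<close>

definition fser :: "(int \<Rightarrow> complex) \<Rightarrow> real \<Rightarrow> complex"
  where "fser a y = (\<Sum>\<^sub>\<infinity>k. a k * fexp k y)"

lemma fourier_fser:
  assumes "(\<lambda>k. cmod (a k)) summable_on UNIV"
  shows "fourier (fser a) = a"
  using fourier_series(3)[OF assms] by (auto simp: fser_def[abs_def])

lemma summable_fser: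
  assumes "(\<lambda>k. cmod (a k)) summable_on UNIV"
  shows "(\<lambda>k. a k * fexp k y) summable_on UNIV"
  by (rule abs_summable_summable) (use assms in \<open>simp add: norm_mult\<close>)

text \<open>The function and the sum of its series are continuous, periodic and have the same
  coefficients, so \<open>fourier_eq_0_imp_eq_0\<close> applies to their difference.\<close>

lemma fser_fourier:
  assumes cont: "continuous_on UNIV f" and per: "\<And>y. f (y + 1) = f y"
    and summ: "(\<lambda>k. cmod (fourier f k)) summable_on UNIV"
  shows "fser (fourier f) = f"
proof
  fix y
  define g where "g = fser (fourier f)"
  have g: "continuous_on UNIV g" "\<And>y. g (y + 1) = g y" "fourier g = fourier f"
    using fourier_series[OF summ] by (auto simp: g_def fser_def[abs_def])
  have "continuous_on UNIV (\<lambda>y. - 1 * g y)" by (intro continuous_intros g)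
  from fourier_add[OF cont this] fourier_scale[of "- 1" g]
  have "fourier (\<lambda>y. f y + - 1 * g y) k = 0" for k
    by (simp add: g(3))
  then have "f y + - 1 * g y = 0"
    by (intro fourier_eq_0_imp_eq_0[where f = "\<lambda>y. f y + - 1 * g y"] continuous_intros cont g) (simp add: per g)
  then show "fser (fourier f) y = f y" by (simp add: g_def)
qed

lemma fser_mult:
  assumes a: "(\<lambda>k. cmod (a k)) summable_on UNIV" and b: "(\<lambda>k. cmod (b k)) summable_on UNIV"
  shows "fser a y * fser b y = fser (conv a b) y"
proof -
  have s: "(\<lambda>(m, j). a m * b j * fexp (m + j) y) summable_on UNIV \<times> UNIV"
    using abs_summable_summable[OF abs_summable_conv_pairs[OF a b, where z = "\<lambda>k. fexp k y" and Z = 1]] by simp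
  have "fser (conv a b) y = (\<Sum>\<^sub>\<infinity>(m, j)\<in>UNIV \<times> UNIV. a m * b j * fexp (m + j) y)"
    using infsumI[OF conv_has_sum[OF a b, of "\<lambda>k. fexp k y" 1]] by (simp add: fser_def)
  also have "\<dots> = (\<Sum>\<^sub>\<infinity>m. \<Sum>\<^sub>\<infinity>j. a m * b j * fexp (m + j) y)"
    using infsum_Sigma_banach[OF s] by simp
  also have "\<dots> = (\<Sum>\<^sub>\<infinity>m. a m * fexp m y * fser b y)"
    unfolding fser_def
    by (subst infsum_cmult_right'[symmetric]) (simp add: fexp_mult[symmetric] mult_ac)
  also have "\<dots> = fser a y * fser b y"
    unfolding fser_def by (rule infsum_cmult_left')
  finally show ?thesis by simp
qed

lemma fser_diff:
  assumes a: "(\<lambda>k. cmod (a k)) summable_on UNIV" and b: "(\<lambda>k. cmod (b k)) summable_on UNIV"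
  shows "fser a y - fser b y = fser (\<lambda>k. a k - b k) y"
  using infsum_add[OF summable_fser[OF a] summable_on_cmult_right[OF summable_fser[OF b], of "- 1"], of y y]
  by (simp add: fser_def left_diff_distrib infsum_uminus)

lemma fser_reflect: "fser a (- y) = fser (\<lambda>k. a (- k)) y"
proof -
  have "fexp k (- y) = fexp (- k) y" for k
    by (simp add: fexp_def)
  then have "fser a (- y) = (\<Sum>\<^sub>\<infinity>k. a k * fexp (- k) y)" by (simp add: fser_def)
  also have "\<dots> = (\<Sum>\<^sub>\<infinity>k. a (- k) * fexp k y)"
    using infsum_int_diff[of "\<lambda>k. a k * fexp (- k) y" 0] by simp
  finally show ?thesis by (simp add: fser_def)
qed

lemma Pi_plus_fser: "Pi_plus f = fser (\<lambda>k. if 0 \<le> k then fourier f k else 0)"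
  unfolding Pi_plus_def[abs_def] fser_def[abs_def]
  by (intro ext infsum_cong_neutral) auto

lemma Pi_plus0_fser: "Pi_plus0 f = fser (\<lambda>k. if 1 \<le> k then fourier f k else 0)"
  unfolding Pi_plus0_def[abs_def] fser_def[abs_def]
  by (intro ext infsum_cong_neutral) auto

lemma fourier_Lop_pow: "fourier ((Lop ^^ j) f) n = fourier f (n + int j)"
proof -
  have "(Lop ^^ j) f y = f y * fexp (- int j) y" for y
    by (induction j) (simp_all add: Lop_def mult.assoc fexp_mult algebra_simps)
  then show ?thesis
    by (simp add: fourier_def mult.assoc fexp_mult algebra_simps)
qed

lemma hcoeff_summable: "(\<lambda>k. cmod (hcoeff f k)) summable_on UNIV"
  by (rule wsq_summable_imp_abs_summable[OF hcoeff_wsq])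

lemma hcoeff_nonpos [simp]: "k \<le> 0 \<Longrightarrow> hcoeff f k = 0"
  using Rep_hardy[of f] by (simp add: H1_plus0_def)

lemma fser_hcoeff: "fser (hcoeff f) = Rep_hardy f"
  using Rep_hardy[of f] by (intro fser_fourier hcoeff_summable) (auto simp: H1_plus0_def H1_def)

lemma norm_hardy_wnorm: "norm f = wnorm (hcoeff f)"
  by (simp add: norm_hardy_wsq wnorm_def)


section \<open>Complex linear and bilinear maps\<close>

text \<open>Complex homogeneity is added to the real notion, so that the calculus of
  \<open>bounded_linear\<close> maps, derivatives included, stays applicable.\<close>

definition bounded_linearC :: "('a::complex_normed_vector \<Rightarrow> 'b::complex_normed_vector) \<Rightarrow> bool"
  where "bounded_linearC f \<longleftrightarrow> bounded_linear f \<and> (\<forall>c x. f (c *\<^sub>C x) = c *\<^sub>C f x)"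

definition bounded_bilinearC :: "('a::complex_normed_vector \<Rightarrow> 'b::complex_normed_vector \<Rightarrow> 'c::complex_normed_vector) \<Rightarrow> bool"
  where "bounded_bilinearC B \<longleftrightarrow> bounded_bilinear B \<and>
    (\<forall>c x y. B (c *\<^sub>C x) y = c *\<^sub>C B x y) \<and> (\<forall>c x y. B x (c *\<^sub>C y) = c *\<^sub>C B x y)"

lemma bounded_linearCI:
  assumes "\<And>x y. f (x + y) = f x + f y" "\<And>c x. f (c *\<^sub>C x) = c *\<^sub>C f x" "\<And>x. norm (f x) \<le> K * norm x"
  shows "bounded_linearC f"
  unfolding bounded_linearC_def
  by (auto intro!: bounded_linear_intro[where K = K] simp: assms mult.commute simp flip: scaleC_of_real)

lemma bounded_bilinearCI:
  assumes "\<And>x x' y. B (x + x') y = B x y + B x' y" "\<And>x y y'. B x (y + y') = B x y + B x y'"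
    "\<And>c x y. B (c *\<^sub>C x) y = c *\<^sub>C B x y" "\<And>c x y. B x (c *\<^sub>C y) = c *\<^sub>C B x y"
    "\<And>x y. norm (B x y) \<le> K * norm x * norm y"
  shows "bounded_bilinearC B"
proof -
  have "bounded_bilinear B"
    by standard (use assms in \<open>auto simp: mult_ac simp flip: scaleC_of_real intro!: exI[of _ K]\<close>)
  with assms show ?thesis by (simp add: bounded_bilinearC_def)
qed


section \<open>Operators on the Hardy space\<close>

text \<open>Meaningful for weighted square-summable sequences supported on positive indices. The
  description has the same form as those in \<open>hamiltonian_field\<close>, which can thus be
  folded into it.\<close>

definition hardy_of :: "(int \<Rightarrow> complex) \<Rightarrow> hardy"
  where "hardy_of a = (THE f. hcoeff f = a)"

lemma hardy_of_hcoeff [simp]: "hardy_of (hcoeff f) = f"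
  unfolding hardy_of_def by (rule the_equality) (auto simp: hcoeff_inject)

lemma hcoeff_hardy_of:
  assumes "wsq a summable_on UNIV" "\<And>k. k \<le> 0 \<Longrightarrow> a k = 0"
  shows "hcoeff (hardy_of a) = a"
  using hardy_of_coeffs[of a] assms by (metis hardy_of_hcoeff)

definition hmult :: "hardy \<Rightarrow> hardy \<Rightarrow> hardy"
  where "hmult f g = hardy_of (conv (hcoeff f) (hcoeff g))"

text \<open>On coefficients this is \<open>\<Gamma>(f)g\<close>: reflecting \<open>g\<close>
  reverses its indices, and the projection keeps the positive ones.\<close>

definition hankel :: "hardy \<Rightarrow> hardy \<Rightarrow> hardy"
  where "hankel f g = hardy_of (\<lambda>n. if 1 \<le> n then conv (hcoeff f) (\<lambda>m. hcoeff g (- m)) n else 0)"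

text \<open>This is \<open>L\<close> followed by \<open>\<Pi>\<^sup>+\<^sub>0\<close>: the
  coefficient with index 1 would move to 0 and is dropped.\<close>

definition lshift :: "hardy \<Rightarrow> hardy"
  where "lshift f = hardy_of (\<lambda>n. if 1 \<le> n then hcoeff f (n + 1) else 0)"

definition rshift :: "hardy \<Rightarrow> hardy"
  where "rshift f = hardy_of (\<lambda>n. hcoeff f (n - 1))"

definition hpair :: "hardy \<Rightarrow> hardy \<Rightarrow> complex"
  where "hpair f g = (\<Sum>\<^sub>\<infinity>k. hcoeff f k * hcoeff g k)"

section \<open>Coefficients and boundedness of the operators\<close>

lemma wsq_reflect:
  assumes "wsq a summable_on UNIV"
  shows "wsq (\<lambda>m. a (- m)) summable_on UNIV" "wnorm (\<lambda>m. a (- m)) \<le> wnorm a"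
  by (rule wsq_dominated[OF assms, where C = 1 and \<sigma> = uminus, simplified]; auto simp: jap_def)+

lemma wsq_restrict:
  assumes "wsq a summable_on UNIV"
  shows "wsq (\<lambda>m. if P m then a m else 0) summable_on UNIV" "wnorm (\<lambda>m. if P m then a m else 0) \<le> wnorm a"
  by (rule wsq_dominated[OF assms, where C = 1 and \<sigma> = id, simplified]; auto)+

lemma conv_pos_eq_0:
  assumes "\<And>k. k \<le> 0 \<Longrightarrow> a k = 0" "\<And>k. k \<le> 0 \<Longrightarrow> b k = 0" "n \<le> 1"
  shows "conv a b n = 0"
proof -
  have "a m * b (n - m) = 0" for m
    using assms(1)[of m] assms(2)[of "n - m"] assms(3) by (cases "m \<le> 0") auto
  then show ?thesis unfolding conv_def by (intro infsum_0) blast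
qed

lemma hcoeff_hmult: "hcoeff (hmult f g) = conv (hcoeff f) (hcoeff g)"
  unfolding hmult_def
  by (rule hcoeff_hardy_of) (auto intro: wsq_conv hcoeff_wsq conv_pos_eq_0)

lemma wsq_hankel: "wsq (conv (hcoeff f) (\<lambda>m. hcoeff g (- m))) summable_on UNIV"
  by (intro wsq_conv wsq_reflect hcoeff_wsq)

lemma hcoeff_hankel:
  "hcoeff (hankel f g) = (\<lambda>n. if 1 \<le> n then conv (hcoeff f) (\<lambda>m. hcoeff g (- m)) n else 0)"
  unfolding hankel_def by (rule hcoeff_hardy_of) (auto intro: wsq_restrict wsq_hankel)

lemma wsq_lshift:
  "wsq (\<lambda>n. if 1 \<le> n then hcoeff f (n + 1) else 0) summable_on UNIV"
  "wnorm (\<lambda>n. if 1 \<le> n then hcoeff f (n + 1) else 0) \<le> 1 * norm f"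
  unfolding norm_hardy_wnorm
  by (rule wsq_dominated[OF hcoeff_wsq[of f], where C = 1 and \<sigma> = "\<lambda>n. n + 1"];
    auto simp: inj_on_def jap_def intro!: mult_left_mono)+

lemma hcoeff_lshift: "hcoeff (lshift f) = (\<lambda>n. if 1 \<le> n then hcoeff f (n + 1) else 0)"
  unfolding lshift_def by (rule hcoeff_hardy_of) (auto intro: wsq_lshift)

lemma wsq_rshift:
  "wsq (\<lambda>n. hcoeff f (n - 1)) summable_on UNIV" "wnorm (\<lambda>n. hcoeff f (n - 1)) \<le> 2 * norm f"
proof -
  have "cmod (hcoeff f (k - 1)) * jap k \<le> 2 * (cmod (hcoeff f (k - 1)) * jap (k - 1))"
    if "hcoeff f (k - 1) \<noteq> 0" for k
  proof -
    have "\<not> k - 1 \<le> 0" using that hcoeff_nonpos by blast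
    \<comment> \<open>Here \<open>k \<ge> 2\<close>, and \<open>k / (k - 1)\<close> is at most 2,
      with equality at \<open>k = 2\<close>.\<close>
    then have "jap k \<le> 2 * jap (k - 1)" by (auto simp: jap_def)
    from mult_left_mono[OF this norm_ge_zero[of "hcoeff f (k - 1)"]] show ?thesis by (simp add: mult_ac)
  qed
  note * = wsq_dominated[OF hcoeff_wsq[of f] _ _ this]
  show "wsq (\<lambda>n. hcoeff f (n - 1)) summable_on UNIV" "wnorm (\<lambda>n. hcoeff f (n - 1)) \<le> 2 * norm f"
    unfolding norm_hardy_wnorm by (rule *; simp add: inj_on_def)+
qed

lemma hcoeff_rshift: "hcoeff (rshift f) = (\<lambda>n. hcoeff f (n - 1))"
  unfolding rshift_def by (rule hcoeff_hardy_of) (auto intro: wsq_rshift)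

lemma hcoeff_reflect_summable: "(\<lambda>k. cmod (hcoeff f (- k))) summable_on UNIV"
  by (rule wsq_summable_imp_abs_summable[OF wsq_reflect(1)[OF hcoeff_wsq]])

lemma conv_add:
  assumes "(\<lambda>k. cmod (a k)) summable_on UNIV" "(\<lambda>k. cmod (b k)) summable_on UNIV" "(\<lambda>k. cmod (c k)) summable_on UNIV"
  shows "conv (\<lambda>k. a k + b k) c n = conv a c n + conv b c n"
    and "conv c (\<lambda>k. a k + b k) n = conv c a n + conv c b n"
  unfolding conv_def using assms
  by (auto simp: distrib_left distrib_right intro!: infsum_add summable_conv_terms)

lemma conv_scale: "conv (\<lambda>k. c * a k) b n = c * conv a b n" "conv a (\<lambda>k. c * b k) n = c * conv a b n"
  unfolding conv_def by (simp_all add: mult_ac flip: infsum_cmult_right')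

lemma bounded_bilinearC_hmult: "bounded_bilinearC hmult"
proof (rule bounded_bilinearCI)
  show "norm (hmult f g) \<le> 2 * jap_const * norm f * norm g" for f g
    by (simp add: norm_hardy_wnorm hcoeff_hmult wsq_conv hcoeff_wsq)
qed (auto simp: hcoeff_inject[symmetric] fun_eq_iff hcoeff_hmult hcoeff_add hcoeff_scaleC
    hcoeff_add[abs_def] hcoeff_scaleC[abs_def] conv_add hcoeff_summable conv_scale)

lemma bounded_bilinearC_hankel: "bounded_bilinearC hankel"
proof (rule bounded_bilinearCI)
  fix f g
  have "norm (hankel f g) \<le> wnorm (conv (hcoeff f) (\<lambda>m. hcoeff g (- m)))"
    by (simp add: norm_hardy_wnorm hcoeff_hankel wsq_restrict wsq_hankel)
  also have "\<dots> \<le> 2 * jap_const * wnorm (hcoeff f) * wnorm (\<lambda>m. hcoeff g (- m))"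
    by (intro wsq_conv wsq_reflect hcoeff_wsq)
  also have "\<dots> \<le> 2 * jap_const * norm f * norm g"
    by (auto simp: norm_hardy_wnorm intro!: mult_left_mono wsq_reflect hcoeff_wsq)
  finally show "norm (hankel f g) \<le> 2 * jap_const * norm f * norm g" .
qed (auto simp: hcoeff_inject[symmetric] fun_eq_iff hcoeff_hankel hcoeff_add hcoeff_scaleC
    hcoeff_add[abs_def] hcoeff_scaleC[abs_def] conv_add hcoeff_summable hcoeff_reflect_summable conv_scale)

lemma bounded_linearC_lshift: "bounded_linearC lshift"
proof (rule bounded_linearCI)
  show "norm (lshift f) \<le> 1 * norm f" for f
    using wsq_lshift(2)[of f] by (simp add: norm_hardy_wnorm[of "lshift f"] hcoeff_lshift)
qed (auto simp: hcoeff_inject[symmetric] fun_eq_iff hcoeff_lshift hcoeff_add hcoeff_scaleC)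

lemma bounded_linearC_rshift: "bounded_linearC rshift"
proof (rule bounded_linearCI)
  show "norm (rshift f) \<le> 2 * norm f" for f
    using wsq_rshift(2)[of f] by (simp add: norm_hardy_wnorm[of "rshift f"] hcoeff_rshift)
qed (auto simp: hcoeff_inject[symmetric] fun_eq_iff hcoeff_rshift hcoeff_add hcoeff_scaleC)

section \<open>The bilinear pairing and transposes\<close>

lemma hpair_abs_summable: "(\<lambda>k. cmod (hcoeff f k * hcoeff g k)) summable_on UNIV"
  by (rule summable_on_comparison_test[OF summable_on_cmult_left[OF hcoeff_summable[of f], of "norm g"]])
    (auto simp: norm_mult intro!: mult_left_mono norm_hcoeff_le)

lemma hpair_has_sum: "((\<lambda>k. hcoeff f k * hcoeff g k) has_sum hpair f g) UNIV"
  unfolding hpair_def by (rule has_sum_infsum[OF abs_summable_summable[OF hpair_abs_summable]])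

lemma hpair_commute: "hpair f g = hpair g f"
  by (simp add: hpair_def mult.commute)

lemma hpair_add_left: "hpair (f + f') g = hpair f g + hpair f' g"
  using has_sum_add[OF hpair_has_sum[of f g] hpair_has_sum[of f' g]] hpair_has_sum[of "f + f'" g]
  by (auto simp: hcoeff_add distrib_right intro: has_sum_unique)

lemma hpair_scaleC_left: "hpair (c *\<^sub>C f) g = c *\<^sub>C hpair f g"
  by (simp add: hpair_def hcoeff_scaleC scaleC_complex_def mult.assoc infsum_cmult_right')

lemma bounded_bilinearC_hpair: "bounded_bilinearC hpair"
proof (rule bounded_bilinearCI)
  fix f g
  have "norm (hpair f g) \<le> (\<Sum>\<^sub>\<infinity>k. cmod (hcoeff f k * hcoeff g k))"
    unfolding hpair_def by (rule norm_infsum_bound[OF hpair_abs_summable])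
  also have "\<dots> \<le> (\<Sum>\<^sub>\<infinity>k. cmod (hcoeff f k) * norm g)"
    by (intro infsum_mono hpair_abs_summable summable_on_cmult_left hcoeff_summable)
      (auto simp: norm_mult intro!: mult_left_mono norm_hcoeff_le)
  also have "\<dots> = (\<Sum>\<^sub>\<infinity>k. cmod (hcoeff f k)) * norm g"
    by (rule infsum_cmult_left')
  also have "\<dots> \<le> jap_const * norm f * norm g"
    unfolding norm_hardy_wnorm by (intro mult_right_mono infsum_cmod_le_wnorm hcoeff_wsq) simp
  finally show "norm (hpair f g) \<le> jap_const * norm f * norm g" .
qed (metis hpair_add_left hpair_scaleC_left hpair_commute)+

lemma hmult_commute: "hmult f g = hmult g f"
proof -
  have "conv a b n = conv b a n" for a b n
    using infsum_int_diff[of "\<lambda>m. a m * b (n - m)" n] by (simp add: conv_def mult.commute)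
  then have "conv a b = conv b a" for a b by blast
  then show ?thesis by (simp add: hmult_def)
qed

lemma hpair_hmult: "hpair (hmult f g) h = (\<Sum>\<^sub>\<infinity>(m, j). hcoeff f m * hcoeff g j * hcoeff h (m + j))"
  unfolding hpair_def hcoeff_hmult
  by (rule infsumI[OF conv_has_sum[OF hcoeff_summable hcoeff_summable norm_hcoeff_le]])

text \<open>Both sides are one trilinear sum, over indices where that of \<open>f\<close> is the sum
  of those of \<open>g\<close> and \<open>h\<close>.\<close>

lemma hpair_hankel: "hpair (hankel f g) h = hpair (hmult g h) f"
proof -
  have "hpair (hankel f g) h = (\<Sum>\<^sub>\<infinity>n. conv (hcoeff f) (\<lambda>m. hcoeff g (- m)) n * hcoeff h n)"
    \<comment> \<open>The truncation in \<open>hankel\<close> disappears because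
      \<open>hcoeff h\<close> vanishes at nonpositive indices.\<close>
    unfolding hpair_def hcoeff_hankel by (rule infsum_cong) auto
  also have "\<dots> = (\<Sum>\<^sub>\<infinity>(m, j). hcoeff f m * hcoeff g (- j) * hcoeff h (m + j))"
    by (rule infsumI[OF conv_has_sum[OF hcoeff_summable hcoeff_reflect_summable norm_hcoeff_le]])
  also have "\<dots> = (\<Sum>\<^sub>\<infinity>(m, j). hcoeff g m * hcoeff h j * hcoeff f (m + j))"
    by (rule infsum_reindex_bij_witness[of _ "\<lambda>(m, j). (m + j, - m)" "\<lambda>(m, j). (- j, m + j)"]) auto
  finally show ?thesis by (simp add: hpair_hmult)
qed

lemma hpair_lshift: "hpair (lshift f) g = hpair f (rshift g)"
proof -
  have "hpair (lshift f) g = (\<Sum>\<^sub>\<infinity>n. hcoeff f (n + 1) * hcoeff g n)"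
    unfolding hpair_def hcoeff_lshift by (rule infsum_cong) auto
  also have "\<dots> = (\<Sum>\<^sub>\<infinity>n. hcoeff f n * hcoeff g (n - 1))"
    by (rule infsum_reindex_bij_witness[of _ "\<lambda>n. n - 1" "\<lambda>n. n + 1"]) auto
  finally show ?thesis by (simp add: hpair_def hcoeff_rshift)
qed

lemma hpair_lshift_pow: "hpair ((lshift ^^ k) f) g = hpair f ((rshift ^^ k) g)"
  by (induction k arbitrary: g) (simp_all add: hpair_lshift funpow_swap1[of rshift])

text \<open>From a positive index on, the intermediate truncations never remove a coefficient that
  is still to be read.\<close>

lemma hcoeff_lshift_pow: "1 \<le> n \<Longrightarrow> hcoeff ((lshift ^^ k) f) n = hcoeff f (n + int k)"
  by (induction k arbitrary: n) (simp_all add: hcoeff_lshift algebra_simps)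


section \<open>The Hamiltonian in terms of the Hardy space operators\<close>

lemma Gamma_op_hankel: "Gamma_op (Rep_hardy w) (Rep_hardy p) = Rep_hardy (hankel w p)"
proof -
  let ?c = "conv (hcoeff w) (\<lambda>m. hcoeff p (- m))"
  have "(\<lambda>y. Rep_hardy w y * Rep_hardy p (- y)) = fser ?c"
    using fser_mult[OF hcoeff_summable[of w] hcoeff_reflect_summable[of p]] fser_reflect[of "hcoeff p"]
    by (simp add: fser_hcoeff fun_eq_iff)
  moreover have "fourier (fser ?c) = ?c"
    by (intro fourier_fser abs_summable_conv hcoeff_summable hcoeff_reflect_summable)
  ultimately have *: "fourier (\<lambda>y. Rep_hardy w y * Rep_hardy p (- y)) = ?c" by simp
  show ?thesis
    unfolding Gamma_op_def Pi_plus0_fser * hcoeff_hankel[symmetric] by (rule fser_hcoeff)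
qed

text \<open>The coefficients of \<open>\<Pi>\<^sup>+(L^(k+1) f)\<close> start at index 0 and are
  those of \<open>(lshift ^^ k) f\<close> moved left by one place. Pulling this last shift out of
  the product leaves two factors in the Hardy space, so that \<open>hmult\<close> applies. Positive
  \<open>n\<close> suffice because the result is paired with \<open>p\<close>.\<close>

lemma fourier_A_op:
  assumes "1 \<le> n"
  shows "fourier (A_op k (Rep_hardy w) (Rep_hardy g)) n
    = hcoeff (lshift (hmult g ((lshift ^^ k) w)) - lshift (hmult w ((lshift ^^ k) g))) n"
proof -
  define T where "T f m = (if 0 \<le> m then hcoeff f (m + int (k + 1)) else 0)" for f m
  have "wsq (T f) summable_on UNIV" for f
    by (rule wsq_dominated(1)[OF hcoeff_wsq[of f], where \<sigma> = "\<lambda>m. m + int (k + 1)" and C = 1])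
      (auto simp: T_def inj_on_def jap_def intro!: mult_left_mono)
  then have T: "(\<lambda>m. cmod (T f m)) summable_on UNIV" for f
    by (rule wsq_summable_imp_abs_summable)
  have Pi: "Pi_plus ((Lop ^^ (k + 1)) (Rep_hardy f)) = fser (T f)" for f
    unfolding Pi_plus_fser fourier_Lop_pow T_def ..
  note s = abs_summable_conv[OF hcoeff_summable T]
  have "A_op k (Rep_hardy w) (Rep_hardy g) = fser (\<lambda>n. conv (hcoeff g) (T w) n - conv (hcoeff w) (T g) n)"
    unfolding A_op_def[abs_def] Pi
    using fser_mult[OF hcoeff_summable T] by (simp add: fser_hcoeff fser_diff s fun_eq_iff)
  moreover have "(\<lambda>n. cmod (conv (hcoeff g) (T w) n - conv (hcoeff w) (T g) n)) summable_on UNIV"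
    by (rule summable_on_comparison_test[OF summable_on_add[OF s[of g w] s[of w g]]]) (auto intro: norm_triangle_ineq4)
  ultimately have "fourier (A_op k (Rep_hardy w) (Rep_hardy g)) n = conv (hcoeff g) (T w) n - conv (hcoeff w) (T g) n"
    by (simp add: fourier_fser)
  moreover have "hcoeff (lshift (hmult f ((lshift ^^ k) h))) n = conv (hcoeff f) (T h) n" for f h
  proof -
    \<comment> \<open>For \<open>m > n\<close> both sides vanish: the left by truncation at 0, the
      right because its index \<open>n + 1 - m\<close> is nonpositive.\<close>
    have "T h (n - m) = hcoeff ((lshift ^^ k) h) (n + 1 - m)" for m
      by (cases "m \<le> n") (auto simp: T_def hcoeff_lshift_pow algebra_simps)
    then show ?thesis using assms by (simp add: hcoeff_lshift hcoeff_hmult conv_def)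
  qed
  ultimately show ?thesis by (simp add: hcoeff_diff)
qed


section \<open>Continuous polynomial maps\<close>

text \<open>Finite sums of bounded homogeneous polynomials, each the diagonal of a multilinear map
  as in \<open>analytic_map\<close>. The inductive form reduces closure under bilinear operations to
  a pair of monomials.\<close>

inductive polynomial_at_0 :: "('a::complex_normed_vector \<Rightarrow> 'b::complex_normed_vector) \<Rightarrow> bool" where
  monomial: "bounded_multilinearC n M \<Longrightarrow> polynomial_at_0 (\<lambda>h. M (\<lambda>_. h))"
| add: "polynomial_at_0 f \<Longrightarrow> polynomial_at_0 g \<Longrightarrow> polynomial_at_0 (\<lambda>h. f h + g h)"

text \<open>\<open>analytic_map\<close> asks for an expansion about every point. Building all base
  points into the notion lets sums and products inherit their expansions point by point, in place of
  a binomial expansion of \<open>M\<close> at \<open>a + h\<close>.\<close>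

definition polynomial_map :: "('a::complex_normed_vector \<Rightarrow> 'b::complex_normed_vector) \<Rightarrow> bool"
  where "polynomial_map f \<longleftrightarrow> (\<forall>a. polynomial_at_0 (\<lambda>h. f (a + h)))"

lemma scaleC_zero_right [simp]: "c *\<^sub>C (0 :: 'a::complex_normed_vector) = 0"
  using norm_scaleC[of c "0 :: 'a"] by simp

section \<open>Bounded complex multilinear maps\<close>

lemma bounded_multilinearCI:
  assumes "\<And>v v'. (\<And>i. i < n \<Longrightarrow> v i = v' i) \<Longrightarrow> M v = M v'"
    and "\<And>v i x y. i < n \<Longrightarrow> M (v(i := x + y)) = M (v(i := x)) + M (v(i := y))"
    and "\<And>v i c x. i < n \<Longrightarrow> M (v(i := c *\<^sub>C x)) = c *\<^sub>C M (v(i := x))"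
    and "\<And>v. norm (M v) \<le> C * (\<Prod>i<n. norm (v i))"
  shows "bounded_multilinearC n M"
  unfolding bounded_multilinearC_def
proof (intro conjI allI impI exI[of _ C])
  show "M v = M v'" if "\<forall>i<n. v i = v' i" for v v'
    by (rule assms(1)) (use that in auto)
qed (fact assms)+

lemma bounded_multilinearCD:
  assumes "bounded_multilinearC n M"
  shows "(\<And>i. i < n \<Longrightarrow> v i = v' i) \<Longrightarrow> M v = M v'"
    and "i < n \<Longrightarrow> M (v(i := x + y)) = M (v(i := x)) + M (v(i := y))"
    and "i < n \<Longrightarrow> M (v(i := c *\<^sub>C x)) = c *\<^sub>C M (v(i := x))"
  using assms unfolding bounded_multilinearC_def by blast+

lemma bounded_multilinearC_bound:
  assumes "bounded_multilinearC n M"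
  shows "\<exists>C\<ge>0. \<forall>v. norm (M v) \<le> C * (\<Prod>i<n. norm (v i))"
proof -
  obtain C where C: "\<And>v. norm (M v) \<le> C * (\<Prod>i<n. norm (v i))"
    using assms unfolding bounded_multilinearC_def by blast
  have "norm (M v) \<le> \<bar>C\<bar> * (\<Prod>i<n. norm (v i))" for v
  proof -
    have "C * (\<Prod>i<n. norm (v i)) \<le> \<bar>C\<bar> * (\<Prod>i<n. norm (v i))"
      by (intro mult_right_mono prod_nonneg) auto
    with C[of v] show ?thesis by linarith
  qed
  then show ?thesis by (intro exI[of _ "\<bar>C\<bar>"]) simp
qed

lemma bounded_multilinearC_zero: "bounded_multilinearC n (\<lambda>_. 0)"
  by (rule bounded_multilinearCI[where C = 0]) auto

lemma bounded_multilinearC_add: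
  assumes "bounded_multilinearC n M" "bounded_multilinearC n M'"
  shows "bounded_multilinearC n (\<lambda>v. M v + M' v)"
proof -
  obtain C where C: "\<forall>v. norm (M v) \<le> C * (\<Prod>i<n. norm (v i))"
    using bounded_multilinearC_bound[OF assms(1)] by auto
  obtain C' where C': "\<forall>v. norm (M' v) \<le> C' * (\<Prod>i<n. norm (v i))"
    using bounded_multilinearC_bound[OF assms(2)] by auto
  show ?thesis
  proof (rule bounded_multilinearCI)
    show "norm (M v + M' v) \<le> (C + C') * (\<Prod>i<n. norm (v i))" for v
      using norm_triangle_le[OF add_mono[OF C[rule_format] C'[rule_format]]] by (simp add: distrib_right)
    show "M v + M' v = M v' + M' v'" if "\<And>i. i < n \<Longrightarrow> v i = v' i" for v v'
      using bounded_multilinearCD(1)[OF assms(1), of v v'] bounded_multilinearCD(1)[OF assms(2), of v v'] that by simp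
  qed (simp_all add: bounded_multilinearCD(2,3)[OF assms(1)] bounded_multilinearCD(2,3)[OF assms(2)] scaleC_add_right del: fun_upd_apply)
qed

lemma prod_lessThan_add:
  fixes f :: "nat \<Rightarrow> 'a::comm_monoid_mult"
  shows "(\<Prod>i<m + n. f i) = (\<Prod>i<m. f i) * (\<Prod>i<n. f (m + i))"
  by (induction n) (simp_all add: mult.assoc)

lemma bounded_multilinearC_bilinear:
  assumes B: "bounded_bilinearC B" and M: "bounded_multilinearC m M" and M': "bounded_multilinearC n M'"
  shows "bounded_multilinearC (m + n) (\<lambda>v. B (M v) (M' (\<lambda>i. v (m + i))))"
proof -
  interpret B: bounded_bilinear B using B by (simp add: bounded_bilinearC_def)
  have Bc: "B (c *\<^sub>C x) y = c *\<^sub>C B x y" "B x (c *\<^sub>C y) = c *\<^sub>C B x y" for c x y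
    using B by (simp_all add: bounded_bilinearC_def)
  \<comment> \<open>The first \<open>m\<close> entries of \<open>v\<close> feed \<open>M\<close> and
    the next \<open>n\<close> feed \<open>M'\<close>. An update below \<open>m\<close> is invisible
    to \<open>M'\<close>; an update at \<open>i \<ge> m\<close> is invisible to \<open>M\<close> and
    becomes an update of the shifted sequence at \<open>i - m\<close>.\<close>
  have lo: "(\<lambda>j. (v(i := x)) (m + j)) = (\<lambda>j. v (m + j))" if "i < m" for v :: "nat \<Rightarrow> 'd" and i x
    using that by auto
  have hi: "(\<lambda>j. (v(i := x)) (m + j)) = (\<lambda>j. v (m + j))(i - m := x)" if "\<not> i < m" for v :: "nat \<Rightarrow> 'd" and i x
    using that by (auto simp: fun_eq_iff)
  have hiM: "M (v(i := x)) = M v" if "\<not> i < m" for v i x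
    by (rule bounded_multilinearCD(1)[OF M]) (use that in auto)
  obtain C where C: "0 \<le> C" "\<forall>v. norm (M v) \<le> C * (\<Prod>i<m. norm (v i))"
    using bounded_multilinearC_bound[OF M] by auto
  obtain C' where C': "0 \<le> C'" "\<forall>v. norm (M' v) \<le> C' * (\<Prod>i<n. norm (v i))"
    using bounded_multilinearC_bound[OF M'] by auto
  obtain K where K: "0 \<le> K" "\<forall>x y. norm (B x y) \<le> norm x * norm y * K"
    using B.nonneg_bounded by auto
  show ?thesis
  proof (rule bounded_multilinearCI)
    fix v
    have "norm (M v) * norm (M' (\<lambda>i. v (m + i))) \<le> (C * (\<Prod>i<m. norm (v i))) * (C' * (\<Prod>i<n. norm (v (m + i))))"
      by (intro mult_mono C(2)[rule_format] C'(2)[rule_format] mult_nonneg_nonneg C(1) prod_nonneg) auto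
    from mult_right_mono[OF this K(1)] K(2)[rule_format, of "M v" "M' (\<lambda>i. v (m + i))"]
    show "norm (B (M v) (M' (\<lambda>i. v (m + i)))) \<le> C * C' * K * (\<Prod>i<m + n. norm (v i))"
      unfolding prod_lessThan_add by (simp add: mult_ac)
  next
    fix v v'
    assume "\<And>i. i < m + n \<Longrightarrow> v i = (v' i :: 'd)"
    then show "B (M v) (M' (\<lambda>i. v (m + i))) = B (M v') (M' (\<lambda>i. v' (m + i)))"
      using bounded_multilinearCD(1)[OF M, of v v']
        bounded_multilinearCD(1)[OF M', of "\<lambda>i. v (m + i)" "\<lambda>i. v' (m + i)"] by simp
  next
    fix v i x y assume i: "i < m + n"
    show "B (M (v(i := x + y))) (M' (\<lambda>j. (v(i := x + y)) (m + j))) =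
        B (M (v(i := x))) (M' (\<lambda>j. (v(i := x)) (m + j))) + B (M (v(i := y))) (M' (\<lambda>j. (v(i := y)) (m + j)))"
    proof (cases "i < m")
      case True
      show ?thesis unfolding lo[OF True] bounded_multilinearCD(2)[OF M True] B.add_left ..
    next
      case False
      then have "i - m < n" using i by simp
      show ?thesis
        unfolding hi[OF False] hiM[OF False] bounded_multilinearCD(2)[OF M' \<open>i - m < n\<close>] B.add_right ..
    qed
  next
    fix v i c x assume i: "i < m + n"
    show "B (M (v(i := c *\<^sub>C x))) (M' (\<lambda>j. (v(i := c *\<^sub>C x)) (m + j))) =
        c *\<^sub>C B (M (v(i := x))) (M' (\<lambda>j. (v(i := x)) (m + j)))"
    proof (cases "i < m")
      case True
      show ?thesis unfolding lo[OF True] bounded_multilinearCD(3)[OF M True] Bc ..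
    next
      case False
      then have "i - m < n" using i by simp
      show ?thesis
        unfolding hi[OF False] hiM[OF False] bounded_multilinearCD(3)[OF M' \<open>i - m < n\<close>] Bc ..
    qed
  qed
qed

section \<open>Polynomials and their finite power series\<close>

lemma polynomial_at_0_const: "polynomial_at_0 (\<lambda>h. c)"
  using polynomial_at_0.monomial[of 0 "\<lambda>_. c"]
  by (auto simp: bounded_multilinearC_def intro!: exI[of _ "norm c"])

lemma polynomial_at_0_linear:
  assumes "bounded_linearC f"
  shows "polynomial_at_0 f"
proof -
  interpret bounded_linear f using assms by (simp add: bounded_linearC_def)
  obtain K where "\<And>x. norm (f x) \<le> norm x * K" using bounded by blast
  then have "bounded_multilinearC 1 (\<lambda>v. f (v 0))"
    using assms by (auto simp: bounded_multilinearC_def bounded_linearC_def add mult.commute intro!: exI[of _ K])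
  from polynomial_at_0.monomial[OF this] show ?thesis by simp
qed

lemma polynomial_at_0_bilinear:
  assumes B: "bounded_bilinearC B" and f: "polynomial_at_0 f" and g: "polynomial_at_0 g"
  shows "polynomial_at_0 (\<lambda>h. B (f h) (g h))"
  using f
proof induction
  case (monomial m M)
  note M = this
  show ?case
    using g
  proof induction
    case (monomial n M')
    show ?case
      by (rule polynomial_at_0.monomial[OF bounded_multilinearC_bilinear[OF B M monomial]])
  next
    case (add g1 g2)
    have "B x (y + z) = B x y + B x z" for x y z
      using B by (simp add: bounded_bilinearC_def bounded_bilinear.add_right)
    then show ?case using polynomial_at_0.add[OF add.IH] by simp
  qed
next
  case (add f1 f2)
  have "B (x + y) z = B x z + B y z" for x y z
    using B by (simp add: bounded_bilinearC_def bounded_bilinear.add_left)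
  then show ?case using polynomial_at_0.add[OF add.IH] by simp
qed

text \<open>\<open>analytic_map\<close> has one multilinear map per degree, so monomials of equal
  degree are merged. Vanishing from \<open>N\<close> on allows two expansions to be padded to a
  common length.\<close>

lemma polynomial_at_0_series:
  assumes "polynomial_at_0 f"
  shows "\<exists>N M. (\<forall>n. bounded_multilinearC n (M n)) \<and> (\<forall>n\<ge>N. \<forall>v. M n v = 0) \<and>
    (\<forall>h. f h = (\<Sum>n<N. M n (\<lambda>_. h)))"
  using assms
proof induction
  case (monomial m M)
  show ?case
    by (rule exI[of _ "Suc m"], rule exI[of _ "\<lambda>n. if n = m then M else (\<lambda>_. 0)"])
      (use monomial bounded_multilinearC_zero in auto)
next
  case (add f g)
  then obtain N1 M1 N2 M2 where
    1: "\<And>n. bounded_multilinearC n (M1 n)" "\<And>n v. n \<ge> N1 \<Longrightarrow> M1 n v = 0" "\<And>h. f h = (\<Sum>n<N1. M1 n (\<lambda>_. h))" and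
    2: "\<And>n. bounded_multilinearC n (M2 n)" "\<And>n v. n \<ge> N2 \<Longrightarrow> M2 n v = 0" "\<And>h. g h = (\<Sum>n<N2. M2 n (\<lambda>_. h))"
    by blast
  let ?N = "max N1 N2"
  have "f h = (\<Sum>n<?N. M1 n (\<lambda>_. h))" for h
    unfolding 1(3) by (rule sum.mono_neutral_left) (auto intro!: 1(2))
  moreover have "g h = (\<Sum>n<?N. M2 n (\<lambda>_. h))" for h
    unfolding 2(3) by (rule sum.mono_neutral_left) (auto intro!: 2(2))
  ultimately have "\<forall>h. f h + g h = (\<Sum>n<?N. M1 n (\<lambda>_. h) + M2 n (\<lambda>_. h))"
    by (simp add: sum.distrib)
  with 1 2 show ?case
    by (intro exI[of _ ?N] exI[of _ "\<lambda>n v. M1 n v + M2 n v"]) (auto intro: bounded_multilinearC_add)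
qed

lemma analytic_map_polynomial:
  assumes "polynomial_map f"
  shows "analytic_map f"
  unfolding analytic_map_def
proof
  fix a
  obtain N M where M: "\<And>n. bounded_multilinearC n (M n)" "\<And>n v. n \<ge> N \<Longrightarrow> M n v = 0"
    "\<And>h. f (a + h) = (\<Sum>n<N. M n (\<lambda>_. h))"
    using polynomial_at_0_series assms unfolding polynomial_map_def by metis
  have "(\<Sum>n<N'. M n (\<lambda>_. h)) = f (a + h)" if "N' \<ge> N" for N' h
    unfolding M(3) by (rule sum.mono_neutral_right) (use that M(2) in auto)
  \<comment> \<open>The partial sums are exact from \<open>N\<close> on, so the convergence is
    trivially uniform and the radius 1 is an arbitrary choice.\<close>
  then have "uniform_limit (ball 0 1) (\<lambda>N h. \<Sum>n<N. M n (\<lambda>_. h)) (\<lambda>h. f (a + h)) sequentially"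
    by (intro uniform_limitI) (auto simp: eventually_sequentially intro!: exI[of _ N])
  with M(1) show "\<exists>r>0. \<exists>M. (\<forall>n. bounded_multilinearC n (M n)) \<and>
      uniform_limit (ball 0 r) (\<lambda>N h. \<Sum>n<N. M n (\<lambda>_. h)) (\<lambda>h. f (a + h)) sequentially"
    using zero_less_one by blast
qed

section \<open>Closure properties of polynomial maps\<close>

lemma polynomial_map_linear:
  assumes "bounded_linearC f"
  shows "polynomial_map f"
proof -
  have "f (a + h) = f a + f h" for a h
    using assms by (simp add: bounded_linearC_def linear_simps)
  then show ?thesis
    unfolding polynomial_map_def
    using polynomial_at_0.add[OF polynomial_at_0_const polynomial_at_0_linear[OF assms]] by simp
qed

lemma polynomial_map_bilinear:
  assumes "bounded_bilinearC B" "polynomial_map f" "polynomial_map g"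
  shows "polynomial_map (\<lambda>x. B (f x) (g x))"
  using assms polynomial_at_0_bilinear[OF assms(1)] unfolding polynomial_map_def by blast

lemma polynomial_map_add:
  assumes "polynomial_map f" "polynomial_map g"
  shows "polynomial_map (\<lambda>x. f x + g x)"
  using assms polynomial_at_0.add unfolding polynomial_map_def by blast

text \<open>Reduced to the bilinear case: \<open>L (f x)\<close> is the value of the bilinear map
  \<open>c *\<^sub>C L y\<close> at the constant polynomial \<open>c = 1\<close> and at
  \<open>y = f x\<close>.\<close>

lemma polynomial_map_compose_linear:
  assumes L: "bounded_linearC L" and f: "polynomial_map f"
  shows "polynomial_map (\<lambda>x. L (f x))"
proof -
  have "bounded_bilinearC (\<lambda>c x. c *\<^sub>C L x)"
  proof -
    from L interpret bounded_linear L by (simp add: bounded_linearC_def)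
    obtain K where K: "\<And>x. norm (L x) \<le> norm x * K" using bounded by blast
    show ?thesis
    proof (rule bounded_bilinearCI)
      show "norm (c *\<^sub>C L x) \<le> K * norm c * norm x" for c x
        using mult_left_mono[OF K norm_ge_zero[of c]] by (simp add: norm_scaleC mult_ac)
    qed (use L in \<open>auto simp: bounded_linearC_def add scaleC_add_left scaleC_add_right scaleC_scaleC scaleC_complex_def mult.commute\<close>)
  qed
  moreover have "polynomial_map (\<lambda>_. 1 :: complex)"
    by (simp add: polynomial_map_def polynomial_at_0_const)
  moreover have "1 *\<^sub>C x = x" for x :: 'b
    using scaleC_of_real[of 1 x] by simp
  ultimately show ?thesis
    using polynomial_map_bilinear[OF _ _ f] L unfolding bounded_linearC_def by fastforce
qed

lemma bounded_linearC_uminus: "bounded_linearC (uminus :: 'a::complex_normed_vector \<Rightarrow> 'a)"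
proof (rule bounded_linearCI[where K = 1])
  fix c :: complex and x :: 'a
  have "c *\<^sub>C x + c *\<^sub>C (- x) = 0" by (simp flip: scaleC_add_right)
  then show "- (c *\<^sub>C x) = c *\<^sub>C (- x)" by (simp add: minus_unique)
qed auto

lemma polynomial_map_diff:
  assumes "polynomial_map f" "polynomial_map g"
  shows "polynomial_map (\<lambda>x. f x - g x)"
  using polynomial_map_add[OF assms(1) polynomial_map_compose_linear[OF bounded_linearC_uminus assms(2)]] by simp

lemma polynomial_map_Pair:
  assumes "polynomial_map f" "polynomial_map g"
  shows "polynomial_map (\<lambda>x. (f x, g x))"
proof -
  have "bounded_linearC (\<lambda>x::'b. (x, 0 :: 'c))" "bounded_linearC (\<lambda>y::'c. (0 :: 'b, y))"
    by (auto intro!: bounded_linearCI[where K = 1] simp: scaleC_prod_def)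
  from polynomial_map_add[OF polynomial_map_compose_linear[OF this(1) assms(1)]
      polynomial_map_compose_linear[OF this(2) assms(2)]]
  show ?thesis by simp
qed

lemma bounded_linearC_fst: "bounded_linearC fst" and bounded_linearC_snd: "bounded_linearC snd"
  by (auto intro!: bounded_linearCI[where K = 1] simp: scaleC_prod_def norm_fst_le norm_snd_le)

lemma bounded_linearC_funpow:
  fixes L :: "'a::complex_normed_vector \<Rightarrow> 'a"
  assumes "bounded_linearC L"
  shows "bounded_linearC (L ^^ k)"
proof (induction k)
  case 0
  show ?case using bounded_linear_ident by (auto simp: bounded_linearC_def id_def)
next
  case (Suc k)
  then show ?case
    using assms bounded_linear_compose[of L "L ^^ k"] by (simp add: bounded_linearC_def o_def)
qed


section \<open>The gradients\<close>

definition A_hardy :: "nat \<Rightarrow> hardy \<Rightarrow> hardy \<Rightarrow> hardy"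
  where "A_hardy k w g = lshift (hmult g ((lshift ^^ k) w)) - lshift (hmult w ((lshift ^^ k) g))"

text \<open>This is \<open>N(w, p)\<close>, found by transposing the factors of
  \<open>A_hardy k w\<close> one at a time: \<open>lshift\<close> turns into \<open>rshift\<close>,
  and multiplication by \<open>x\<close> turns into \<open>hankel\<close> with \<open>x\<close> as
  second argument.\<close>

definition A_dual :: "nat \<Rightarrow> hardy \<Rightarrow> hardy \<Rightarrow> hardy"
  where "A_dual k w p = hankel (rshift p) ((lshift ^^ k) w) - (rshift ^^ k) (hankel (rshift p) w)"

lemmas hpair_bilinear = bounded_bilinearC_hpair[unfolded bounded_bilinearC_def, THEN conjunct1]

lemmas hpair_diff_left = bounded_bilinear.diff_left[OF hpair_bilinear]
  and hpair_diff_right = bounded_bilinear.diff_right[OF hpair_bilinear]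
  and hpair_add_right = bounded_bilinear.add_right[OF hpair_bilinear]

lemma hpair_A_hardy: "hpair (A_hardy k w g) h = hpair g (A_dual k w h)"
proof -
  have "hpair (lshift (hmult g x)) h = hpair g (hankel (rshift h) x)" for x g
    by (metis hpair_lshift hpair_hankel hpair_commute hmult_commute)
  moreover have "hpair (lshift (hmult w ((lshift ^^ k) g))) h = hpair g ((rshift ^^ k) (hankel (rshift h) w))"
    by (metis calculation hmult_commute hpair_lshift_pow)
  ultimately show ?thesis
    by (simp add: A_hardy_def A_dual_def hpair_diff_left hpair_diff_right)
qed

text \<open>\<open>A_hardy k w g\<close> changes sign when \<open>w\<close> and \<open>g\<close> are
  exchanged; in the pairing the two Hankel terms trade places. This frees an increment of
  \<open>w\<close> from inside \<open>A_dual\<close>.\<close>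

lemma A_dual_antisym: "hpair g (A_dual k h p) = - hpair h (A_dual k g p)"
proof -
  have "hpair g (hankel q ((lshift ^^ k) h)) = hpair h ((rshift ^^ k) (hankel q g))" for g h q
    by (metis hpair_hankel hpair_lshift_pow hpair_commute hmult_commute)
  then show ?thesis
    by (simp add: A_dual_def hpair_diff_right)
qed

lemma I_fun_hpair: "I_fun k (w, p) = hpair (hankel w p) (A_dual k w p)"
proof -
  have "I_fun k (w, p) = (\<Sum>\<^sub>\<infinity>n. fourier (A_op k (Rep_hardy w) (Rep_hardy (hankel w p))) n * hcoeff p n)"
    by (simp add: I_fun_def pairing_def Gamma_op_hankel)
  also have "\<dots> = hpair (A_hardy k w (hankel w p)) p"
    unfolding hpair_def A_hardy_def
    \<comment> \<open>\<open>fourier_A_op\<close> covers the positive modes; at the others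
      \<open>hcoeff p\<close> vanishes.\<close>
    by (rule infsum_cong) (metis fourier_A_op hcoeff_nonpos linorder_not_le int_one_le_iff_zero_less mult_zero_right)
  finally show ?thesis by (simp add: hpair_A_hardy)
qed

text \<open>The first term comes from varying \<open>w\<close> in \<open>hankel w p\<close>, the
  second from varying it in \<open>A_dual k w p\<close>, where antisymmetry produces the minus
  sign.\<close>

definition gradient_w :: "nat \<Rightarrow> hardy \<times> hardy \<Rightarrow> hardy"
  where "gradient_w k = (\<lambda>(w, p). hmult p (A_dual k w p) - A_dual k (hankel w p) p)"

text \<open>The first term comes from varying \<open>p\<close> in \<open>hankel w p\<close>, the
  second from varying it in \<open>A_dual k w p\<close>, transposed back to
  \<open>A_hardy\<close>.\<close>

definition gradient_p :: "nat \<Rightarrow> hardy \<times> hardy \<Rightarrow> hardy"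
  where "gradient_p k = (\<lambda>(w, p). hankel w (A_dual k w p) + A_hardy k w (hankel w p))"

section \<open>Polynomial dependence of the gradients on \<open>(w, p)\<close>\<close>

lemma polynomial_map_hmult:
  assumes "polynomial_map f" "polynomial_map g"
  shows "polynomial_map (\<lambda>x. hmult (f x) (g x))"
  by (rule polynomial_map_bilinear[OF bounded_bilinearC_hmult assms])

lemma polynomial_map_hankel:
  assumes "polynomial_map f" "polynomial_map g"
  shows "polynomial_map (\<lambda>x. hankel (f x) (g x))"
  by (rule polynomial_map_bilinear[OF bounded_bilinearC_hankel assms])

lemmas polynomial_map_shift =
  polynomial_map_compose_linear[OF bounded_linearC_lshift]
  polynomial_map_compose_linear[OF bounded_linearC_rshift]
  polynomial_map_compose_linear[OF bounded_linearC_funpow[OF bounded_linearC_lshift]]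
  polynomial_map_compose_linear[OF bounded_linearC_funpow[OF bounded_linearC_rshift]]

lemma polynomial_map_A_hardy:
  assumes "polynomial_map f" "polynomial_map g"
  shows "polynomial_map (\<lambda>x. A_hardy k (f x) (g x))"
  unfolding A_hardy_def
  by (intro polynomial_map_diff polynomial_map_hmult polynomial_map_shift assms)

lemma polynomial_map_A_dual:
  assumes "polynomial_map f" "polynomial_map g"
  shows "polynomial_map (\<lambda>x. A_dual k (f x) (g x))"
  unfolding A_dual_def
  by (intro polynomial_map_diff polynomial_map_hankel polynomial_map_shift assms)

lemma polynomial_map_gradient:
  shows "polynomial_map (gradient_w k)" and "polynomial_map (gradient_p k)"
  unfolding gradient_w_def gradient_p_def case_prod_unfold
  by (intro polynomial_map_diff polynomial_map_add polynomial_map_hmult polynomial_map_hankel polynomial_map_A_hardy polynomial_map_A_dual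
      polynomial_map_linear[OF bounded_linearC_fst] polynomial_map_linear[OF bounded_linearC_snd])+

section \<open>The differential of the Hamiltonian\<close>

lemmas bounded_linear_shift =
  bounded_linearC_lshift[unfolded bounded_linearC_def, THEN conjunct1]
  bounded_linearC_rshift[unfolded bounded_linearC_def, THEN conjunct1]
  bounded_linearC_funpow[OF bounded_linearC_lshift, unfolded bounded_linearC_def, THEN conjunct1]
  bounded_linearC_funpow[OF bounded_linearC_rshift, unfolded bounded_linearC_def, THEN conjunct1]

lemmas hankel_bilinear = bounded_bilinearC_hankel[unfolded bounded_bilinearC_def, THEN conjunct1]
lemmas hmult_bilinear = bounded_bilinearC_hmult[unfolded bounded_bilinearC_def, THEN conjunct1]

lemma has_derivative_A_dual:
  assumes "(f has_derivative f') (at x)" "(g has_derivative g') (at x)"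
  shows "((\<lambda>x. A_dual k (f x) (g x)) has_derivative (\<lambda>h. A_dual k (f x) (g' h) + A_dual k (f' h) (g x))) (at x)"
proof -
  note r = bounded_linear.has_derivative[OF bounded_linear_shift(2) assms(2)]
  note l = bounded_linear.has_derivative[OF bounded_linear_shift(3)[of k] assms(1)]
  note D = has_derivative_diff[OF bounded_bilinear.FDERIV[OF hankel_bilinear r l]
      bounded_linear.has_derivative[OF bounded_linear_shift(4)[of k] bounded_bilinear.FDERIV[OF hankel_bilinear r assms(1)]]]
  show ?thesis
    unfolding A_dual_def
    by (rule has_derivative_eq_rhs[OF D]) (simp add: fun_eq_iff linear_simps[OF bounded_linear_shift(4)])
qed

lemma has_derivative_I_fun:
  "(I_fun k has_derivative (\<lambda>h. hpair (fst h) (gradient_w k x) + hpair (snd h) (gradient_p k x))) (at x)"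
proof -
  obtain w p where x: "x = (w, p)" by (cases x)
  define N where "N = A_dual k"
  define g where "g = hankel w p"
  have I: "I_fun k = (\<lambda>x. hpair (hankel (fst x) (snd x)) (N (fst x) (snd x)))"
    by (auto simp: I_fun_hpair fun_eq_iff N_def)
  note f = has_derivative_fst[OF has_derivative_ident[of "at (w, p)"]]
    and s = has_derivative_snd[OF has_derivative_ident[of "at (w, p)"]]
  have "(I_fun k has_derivative (\<lambda>h. hpair g (N w (snd h) + N (fst h) p) +
      hpair (hankel w (snd h) + hankel (fst h) p) (N w p))) (at x)"
    unfolding I N_def g_def x
    using bounded_bilinear.FDERIV[OF hpair_bilinear bounded_bilinear.FDERIV[OF hankel_bilinear f s]
        has_derivative_A_dual[OF f s]] by simp
  \<comment> \<open>Each of the four terms of the product rule is transposed until the increment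
    stands alone in the first slot; the second slots then add up to the gradients.\<close>
  moreover have "hpair g (N w (snd h) + N (fst h) p) + hpair (hankel w (snd h) + hankel (fst h) p) (N w p)
      = hpair (fst h) (gradient_w k x) + hpair (snd h) (gradient_p k x)" for h
  proof -
    have "hpair g (N w (snd h)) = hpair (snd h) (A_hardy k w g)"
      by (metis N_def hpair_A_hardy hpair_commute)
    moreover have "hpair g (N (fst h) p) = - hpair (fst h) (N g p)"
      unfolding N_def by (rule A_dual_antisym)
    moreover have "hpair (hankel w (snd h)) (N w p) = hpair (snd h) (hankel w (N w p))"
      by (metis hpair_hankel hpair_commute hmult_commute)
    moreover have "hpair (hankel (fst h) p) (N w p) = hpair (fst h) (hmult p (N w p))"
      by (metis hpair_hankel hpair_commute)
    ultimately show ?thesis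
      by (simp add: x gradient_w_def gradient_p_def N_def g_def hpair_add_left hpair_add_right hpair_diff_right)
  qed
  ultimately show ?thesis by simp
qed

text \<open>The differential at \<open>x\<close> is the pairing \<open>T\<close> of the product
  space with the gradients at \<open>x\<close> in its second slot. It depends on them through a
  bounded linear map, so its continuity in operator norm follows from continuity of the
  gradients.\<close>

lemma C1_map_I_fun: "C1_map (I_fun k)"
proof -
  define T where "T h g = hpair (fst h) (fst g) + hpair (snd h) (snd g)" for h g
  obtain K where K: "0 \<le> K" "\<And>f g. norm (hpair f g) \<le> norm f * norm g * K"
    using bounded_bilinear.nonneg_bounded[OF hpair_bilinear] by auto
  have "bounded_bilinearC T"
  proof (rule bounded_bilinearCI)
    fix h g :: "hardy \<times> hardy"
    obtain h1 h2 g1 g2 where "h = (h1, h2)" "g = (g1, g2)" by (cases h, cases g)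
    then have le: "norm (fst h) \<le> norm h" "norm (snd h) \<le> norm h" "norm (fst g) \<le> norm g" "norm (snd g) \<le> norm g"
      by (simp_all add: norm_fst_le norm_snd_le)
    have "norm (T h g) \<le> norm (fst h) * norm (fst g) * K + norm (snd h) * norm (snd g) * K"
      unfolding T_def by (rule order.trans[OF norm_triangle_ineq add_mono[OF K(2) K(2)]])
    also have "\<dots> \<le> norm h * norm g * K + norm h * norm g * K"
      by (intro add_mono mult_right_mono mult_mono le K) auto
    finally show "norm (T h g) \<le> (2 * K) * norm h * norm g" by (simp add: algebra_simps)
  qed (use bounded_bilinearC_hpair in \<open>auto simp: T_def hpair_add_left hpair_add_right scaleC_prod_def
      bounded_bilinearC_def scaleC_add_right\<close>)
  then have T: "bounded_bilinear T" "\<And>c h g. T (c *\<^sub>C h) g = c *\<^sub>C T h g"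
    by (auto simp: bounded_bilinearC_def)
  define F' where "F' x = bounded_bilinear.prod_left T (gradient_w k x, gradient_p k x)" for x
  have F': "blinfun_apply (F' x) h = hpair (fst h) (gradient_w k x) + hpair (snd h) (gradient_p k x)" for x h
    by (simp add: F'_def bounded_bilinear.prod_left.rep_eq[OF T(1)] T_def)
  have cont: "continuous_on UNIV (\<lambda>x. (gradient_w k x, gradient_p k x))"
    unfolding gradient_w_def gradient_p_def A_dual_def A_hardy_def case_prod_unfold
    by (intro continuous_intros bounded_bilinear.continuous_on[OF hankel_bilinear]
        bounded_bilinear.continuous_on[OF hmult_bilinear] bounded_linear_shift[THEN bounded_linear.continuous_on])
  show ?thesis
    unfolding C1_map_def
  proof (intro exI[of _ F'] conjI allI)
    show "(I_fun k has_derivative blinfun_apply (F' x)) (at x)" for x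
      by (rule has_derivative_eq_rhs[OF has_derivative_I_fun]) (simp add: F' fun_eq_iff)
    show "blinfun_apply (F' x) (c *\<^sub>C h) = c *\<^sub>C blinfun_apply (F' x) h" for x c h
      using T(2)[of c h "(gradient_w k x, gradient_p k x)"] by (simp add: F' T_def)
    show "continuous_on UNIV F'"
      unfolding F'_def by (rule bounded_linear.continuous_on[OF bounded_bilinear.bounded_linear_prod_left[OF T(1)] cont])
  qed
qed

section \<open>Identification of the distributional gradients\<close>

lemma is_gradient_hpair: "is_gradient (\<lambda>h. hpair h g) (hcoeff g)"
proof -
  have "hcoeff g \<in> distribution_coeffs"
    unfolding distribution_coeffs_def mem_Collect_eq
    \<comment> \<open>Coefficients of a Hardy function are bounded by its norm, which is polynomial
      growth of order 0.\<close>
    by (rule exI[of _ "norm g"], rule exI[of _ 0]) (simp add: norm_hcoeff_le)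
  moreover have "((\<lambda>k. hcoeff g k * hcoeff h k) has_sum hpair h g) UNIV" for h
    using hpair_has_sum[of g h] by (simp add: hpair_commute)
  ultimately show ?thesis by (simp add: is_gradient_def)
qed

text \<open>Chain rule along the affine embedding of \<open>w'\<close> as \<open>(w', p)\<close>,
  whose derivative has zero second component.\<close>

lemma D1_I_fun: "D1 (I_fun k) x = (\<lambda>h. hpair h (gradient_w k x))"
proof -
  obtain w p where x: "x = (w, p)" by (cases x)
  have "((\<lambda>w'. (w', p)) has_derivative (\<lambda>h. (h, 0))) (at w)"
    by (auto intro!: derivative_eq_intros)
  from has_derivative_compose[OF this has_derivative_I_fun[of k "(w, p)"]]
  have "((\<lambda>w'. I_fun k (w', p)) has_derivative (\<lambda>h. hpair h (gradient_w k x))) (at w)"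
    by (simp add: x bounded_bilinear.zero_left[OF hpair_bilinear])
  then show ?thesis
    by (simp add: D1_def x frechet_derivative_at[symmetric])
qed

lemma D2_I_fun: "D2 (I_fun k) x = (\<lambda>h. hpair h (gradient_p k x))"
proof -
  obtain w p where x: "x = (w, p)" by (cases x)
  have "((\<lambda>p'. (w, p')) has_derivative (\<lambda>h. (0, h))) (at p)"
    by (auto intro!: derivative_eq_intros)
  from has_derivative_compose[OF this has_derivative_I_fun[of k "(w, p)"]]
  have "((\<lambda>p'. I_fun k (w, p')) has_derivative (\<lambda>h. hpair h (gradient_p k x))) (at p)"
    by (simp add: x bounded_bilinear.zero_left[OF hpair_bilinear])
  then show ?thesis
    by (simp add: D2_def x frechet_derivative_at[symmetric])
qed

lemma grad_I_fun:
  shows "grad_w (I_fun k) x = hcoeff (gradient_w k x)" and "grad_p (I_fun k) x = hcoeff (gradient_p k x)"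
  unfolding grad_w_def grad_p_def D1_I_fun D2_I_fun
  by (rule the_equality, rule is_gradient_hpair, erule is_gradient_unique, rule is_gradient_hpair)+

theorem corollary5p1:
  fixes k :: nat
  assumes "k \<ge> 1"
  shows "hamiltonian_well_defined (I_fun k) \<and> analytic_map (hamiltonian_field (I_fun k))"
proof
  show "hamiltonian_well_defined (I_fun k)"
    unfolding hamiltonian_well_defined_def
    by (auto simp: C1_map_I_fun grad_I_fun D1_I_fun D2_I_fun is_gradient_hpair)
  \<comment> \<open>Each description in the field is \<open>hardy_of\<close> applied to the
    coefficients of a gradient and so returns that gradient.\<close>
  have "hamiltonian_field (I_fun k) = (\<lambda>x. (gradient_p k x, - gradient_w k x))"
    by (intro ext) (simp add: hamiltonian_field_def grad_I_fun flip: hardy_of_def)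
  then show "analytic_map (hamiltonian_field (I_fun k))"
    by (simp add: analytic_map_polynomial polynomial_map_Pair polynomial_map_gradient
        polynomial_map_compose_linear[OF bounded_linearC_uminus])
qed

end
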